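(* Let $X,Y$ be completely regular spaces, $E,F$ normed spaces over $\mathbb K$, and assume that $(A,A(X,E))$ and $(B,A(Y,F))$ are in Situation 1 (as defined in the context), with associated compactifications $\gamma X$ of $X$ and $\gamma Y$ of $Y$. If $T:A(X,E)\to A(Y,F)$ is a biseparating map, then $\gamma X$ and $\gamma Y$ are homeomorphic.
   Context: $\mathbb K=\mathbb R$ or $\mathbb C$. Completely regular spaces are Hausdorff. $C(X,E)$ is the space of continuous functions $X\to E$; $C(X)=C(X,\mathbb K)$. For $f\in C(X,E)$, $c(f):=\{x\in X: f(x)\ne 0\}$ (and similarly for $Y$). Extensions: for continuous $f:X\to\mathbb K$, $f^{\beta X}:\beta X\to\mathbb K\cup\{\infty\}$ (one-point compactification) is its continuous extension to the Stone-Čech compactification; for continuous $f:X\to E$, $\|f\|^{\beta X}$ is the continuous extension to $\beta X$ of $x\mapsto\|f(x)\|$. Compactification $\gamma X$: let $A$ be a subring of $C(X)$ which separates each point of $X$ from each point of $\beta X$ (for $x\in X$, $y\in\beta X$, $x\neq y$, some $f\in A$ has $f^{\beta X}(x)\ne f^{\beta X}(y)$). Put $x\sim y$ in $\beta X$ if $f^{\beta X}(x)=f^{\beta X}(y)$ for all $f\in A$, and $\gamma X:=\beta X/\sim$ (quotient topology). $\gamma X$ is a compactification of $X$, and each $f\in A$ extends continuously to $f^{\gamma X}:\gamma X\to\mathbb K\cup\{\infty\}$. Strongly regular: such an $A$ is strongly regular if for every $x_0\in\gamma X$ and every nonempty closed $K\subset\gamma X$ with $x_0\notin K$ there is $f\in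 A$ with $f^{\gamma X}\equiv1$ on a neighborhood of $x_0$ and $f^{\gamma X}\equiv 0$ on $K$. Compatible: an $A$-module $A(X,E)\subset C(X,E)$ (additive subgroup closed under pointwise multiplication by elements of $A$) is compatible with $A$ if for every $x\in X$ there is $f\in A(X,E)$ with $f(x)\ne0$, and $\|f\|^{\beta X}(x)=\|f\|^{\beta X}(y)$ for all $f\in A(X,E)$ whenever $x,y\in\beta X$, $x\sim y$. Situation 1: $A\subset C(X)$ and $B\subset C(Y)$ are strongly regular rings, $A(X,E)\subset C(X,E)$ is an $A$-module compatible with $A$, and $A(Y,F)\subset C(Y,F)$ is a $B$-module compatible with $B$ ($\gamma Y$ being defined from $B$). Moreover, if $\gamma X\neq\beta X$ (i.e. $\sim$ is not equality), then for every $x\in\beta X$ there is $f\in A(X,E)$ with $\|f\|^{\beta X}(x)\ne0$; and if $\gamma Y\ne\beta Y$, then for every $y\in\beta Y$ there is $g\in A(Y,F)$ with $\|g\|^{\beta Y}(y)\neq0$. A map $T:A(X,E)\to A(Y,F)$ is separating if it is additive and $c(Tf)\cap c(Tg)=\emptyset$ whenever $c(f)\cap c(g)=\emptyset$; it is biseparating if it is bijective and both $T$ and $T^{-1}$ are separating. Linearity is not assumed. *)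

theory Defs
  imports "HOL-Analysis.Analysis"
begin

section \<open>Scalars and normed spaces\<close>

text \<open>The scalar field is \<open>\<real>\<close> or \<open>\<complex>\<close>, up to an isometric isomorphism of fields.\<close>

class real_or_complex = real_normed_field +
  assumes isometric_to_real_or_complex:
    "\<exists>\<phi> :: 'a \<Rightarrow> complex.
       (\<forall>a b. \<phi> (a + b) = \<phi> a + \<phi> b) \<and> (\<forall>a b. \<phi> (a * b) = \<phi> a * \<phi> b) \<and>
       (\<forall>a. norm (\<phi> a) = norm a) \<and> (range \<phi> = \<real> \<or> range \<phi> = UNIV)"

instance real :: real_or_complex
proof
  show "\<exists>\<phi> :: real \<Rightarrow> complex.
       (\<forall>a b. \<phi> (a + b) = \<phi> a + \<phi> b) \<and> (\<forall>a b. \<phi> (a * b) = \<phi> a * \<phi> b) \<and>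
       (\<forall>a. norm (\<phi> a) = norm a) \<and> (range \<phi> = \<real> \<or> range \<phi> = UNIV)"
    by (rule exI[of _ complex_of_real]) (auto simp: Reals_def)
qed

instance complex :: real_or_complex
proof
  show "\<exists>\<phi> :: complex \<Rightarrow> complex.
       (\<forall>a b. \<phi> (a + b) = \<phi> a + \<phi> b) \<and> (\<forall>a b. \<phi> (a * b) = \<phi> a * \<phi> b) \<and>
       (\<forall>a. norm (\<phi> a) = norm a) \<and> (range \<phi> = \<real> \<or> range \<phi> = UNIV)"
    by (rule exI[of _ id]) auto
qed

text \<open>
  A normed space over the scalar field \<open>'k\<close>. The class \<open>real_normed_vector\<close> supplies the
  additive group, the norm and the topology; \<open>sc\<close> is the multiplication by elements of \<open>'k\<close>.
  (By additivity and the norm identity, \<open>sc (of_real r)\<close> coincides with \<open>scaleR r\<close>.)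
\<close>

locale normed_space_over = vector_space sc
  for sc :: "'k::real_or_complex \<Rightarrow> 'e::real_normed_vector \<Rightarrow> 'e" +
  assumes norm_scale: "norm (sc a v) = norm a * norm v"


section \<open>Continuous functions, rings and modules of functions\<close>

text \<open>
  A function on the space \<open>X\<close> is represented by a total function vanishing off \<open>topspace X\<close>, so
  that equality of representatives is equality on \<open>X\<close> and pointwise operations need no restriction.
\<close>

definition C_space :: "'a topology \<Rightarrow> ('a \<Rightarrow> 'v::real_normed_vector) set" where
  "C_space X = {f. continuous_map X euclidean f \<and> (\<forall>x. x \<notin> topspace X \<longrightarrow> f x = 0)}"

definition cozero :: "'a topology \<Rightarrow> ('a \<Rightarrow> 'v::zero) \<Rightarrow> 'a set" where
  "cozero X f = {x \<in> topspace X. f x \<noteq> 0}"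

definition additive_subgroup :: "('a \<Rightarrow> 'v::ab_group_add) set \<Rightarrow> bool" where
  "additive_subgroup M \<longleftrightarrow> (\<lambda>x. 0) \<in> M \<and> (\<forall>f\<in>M. \<forall>g\<in>M. (\<lambda>x. f x - g x) \<in> M)"

text \<open>Subrings are not required to contain the constant function 1.\<close>

definition function_subring :: "'a topology \<Rightarrow> ('a \<Rightarrow> 'k::real_normed_field) set \<Rightarrow> bool" where
  "function_subring X A \<longleftrightarrow>
     A \<subseteq> C_space X \<and> additive_subgroup A \<and> (\<forall>f\<in>A. \<forall>g\<in>A. (\<lambda>x. f x * g x) \<in> A)"

definition function_module ::
  "'a topology \<Rightarrow> ('k \<Rightarrow> 'e \<Rightarrow> 'e) \<Rightarrow> ('a \<Rightarrow> 'k) set \<Rightarrow> ('a \<Rightarrow> 'e::real_normed_vector) set \<Rightarrow> bool" where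
  "function_module X sc A M \<longleftrightarrow>
     M \<subseteq> C_space X \<and> additive_subgroup M \<and> (\<forall>a\<in>A. \<forall>f\<in>M. (\<lambda>x. sc (a x) (f x)) \<in> M)"


section \<open>The Stone-Cech compactification and continuous extensions\<close>

text \<open>
  \<open>\<beta>X\<close> is the closure of the image of \<open>X\<close> in the cube \<open>[0,1]\<^sup>I\<close>, where \<open>I\<close> is the set of continuous
  functions from \<open>X\<close> to \<open>[0,1]\<close>, under the evaluation map.
\<close>

definition unit_functions :: "'a topology \<Rightarrow> ('a \<Rightarrow> real) set" where
  "unit_functions X = {h \<in> C_space X. h ` topspace X \<subseteq> {0..1}}"

definition beta_emb :: "'a topology \<Rightarrow> 'a \<Rightarrow> (('a \<Rightarrow> real) \<Rightarrow> real)" where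
  "beta_emb X x = (\<lambda>h\<in>unit_functions X. h x)"

definition beta :: "'a topology \<Rightarrow> (('a \<Rightarrow> real) \<Rightarrow> real) topology" where
  "beta X =
     (let cube = product_topology (\<lambda>h. top_of_set {0..1}) (unit_functions X)
      in subtopology cube (cube closure_of (beta_emb X ` topspace X)))"

text \<open>
  The continuous extension of \<open>f\<close> to the compactification \<open>Z\<close> of \<open>X\<close> (with embedding \<open>j\<close>), with values
  in the one-point compactification of \<open>'v\<close>, whose point at infinity is \<open>None\<close>. On \<open>topspace Z\<close> it is
  unique, as \<open>j ` topspace X\<close> is dense and the codomain is Hausdorff in the cases used below; its
  values off \<open>topspace Z\<close> are irrelevant.
\<close>

definition extension ::
  "'z topology \<Rightarrow> ('a \<Rightarrow> 'z) \<Rightarrow> 'a topology \<Rightarrow> ('a \<Rightarrow> 'v::topological_space) \<Rightarrow> 'z \<Rightarrow> 'v option" where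
  "extension Z j X f =
     (SOME g. continuous_map Z (Alexandroff_compactification euclidean) g \<and>
              (\<forall>x\<in>topspace X. g (j x) = Some (f x)))"

definition beta_ext ::
  "'a topology \<Rightarrow> ('a \<Rightarrow> 'v::topological_space) \<Rightarrow> (('a \<Rightarrow> real) \<Rightarrow> real) \<Rightarrow> 'v option" where
  "beta_ext X f = extension (beta X) (beta_emb X) X f"

definition norm_beta_ext ::
  "'a topology \<Rightarrow> ('a \<Rightarrow> 'e::real_normed_vector) \<Rightarrow> (('a \<Rightarrow> real) \<Rightarrow> real) \<Rightarrow> real option" where
  "norm_beta_ext X f = beta_ext X (\<lambda>x. norm (f x))"


section \<open>The compactification associated with a ring of functions\<close>

definition separates_points_from_beta ::
  "'a topology \<Rightarrow> ('a \<Rightarrow> 'k::topological_space) set \<Rightarrow> bool" where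
  "separates_points_from_beta X A \<longleftrightarrow>
     (\<forall>x\<in>topspace X. \<forall>p\<in>topspace (beta X). beta_emb X x \<noteq> p \<longrightarrow>
        (\<exists>f\<in>A. beta_ext X f (beta_emb X x) \<noteq> beta_ext X f p))"

definition beta_rel ::
  "'a topology \<Rightarrow> ('a \<Rightarrow> 'k::topological_space) set \<Rightarrow> (('a \<Rightarrow> real) \<Rightarrow> real) rel" where
  "beta_rel X A = {(p, q). p \<in> topspace (beta X) \<and> q \<in> topspace (beta X) \<and>
                           (\<forall>f\<in>A. beta_ext X f p = beta_ext X f q)}"

definition quotient_topology :: "'z topology \<Rightarrow> 'z rel \<Rightarrow> 'z set topology" where
  "quotient_topology Z R = topology (\<lambda>U. U \<subseteq> topspace Z // R \<and> openin Z (\<Union>U))"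

lemma openin_quotient_topology:
  assumes "equiv (topspace Z) R"
  shows "openin (quotient_topology Z R) U \<longleftrightarrow> U \<subseteq> topspace Z // R \<and> openin Z (\<Union>U)"
proof -
  have disj: "P = Q" if "P \<in> topspace Z // R" "Q \<in> topspace Z // R" "p \<in> P" "p \<in> Q" for P Q p
    using quotient_disj[OF assms that(1,2)] that(3,4) by blast
  have "istopology (\<lambda>U. U \<subseteq> topspace Z // R \<and> openin Z (\<Union>U))"
    unfolding istopology_def
  proof (intro conjI allI impI; (elim conjE)?)
    fix S T
    assume S: "S \<subseteq> topspace Z // R" "openin Z (\<Union>S)" and T: "T \<subseteq> topspace Z // R" "openin Z (\<Union>T)"
    show "S \<inter> T \<subseteq> topspace Z // R" using S by blast
    have "\<Union>(S \<inter> T) = \<Union>S \<inter> \<Union>T"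
    proof
      show "\<Union>S \<inter> \<Union>T \<subseteq> \<Union>(S \<inter> T)"
      proof
        fix p assume "p \<in> \<Union>S \<inter> \<Union>T"
        then obtain P Q where PQ: "P \<in> S" "Q \<in> T" "p \<in> P" "p \<in> Q" by blast
        then have "P = Q" using disj S(1) T(1) by blast
        then show "p \<in> \<Union>(S \<inter> T)" using PQ by blast
      qed
    qed blast
    then show "openin Z (\<Union>(S \<inter> T))" using S(2) T(2) by (simp add: openin_Int)
  next
    fix \<K> assume K: "\<forall>K\<in>\<K>. K \<subseteq> topspace Z // R \<and> openin Z (\<Union>K)"
    then show "\<Union>\<K> \<subseteq> topspace Z // R" by blast
    have "\<Union>(\<Union>\<K>) = \<Union>(Union ` \<K>)" by blast
    then show "openin Z (\<Union>(\<Union>\<K>))" using K by (metis (no_types, lifting) imageE openin_Union)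
  qed
  then show ?thesis by (simp add: quotient_topology_def topology_inverse')
qed

lemma equiv_beta_rel: "equiv (topspace (beta X)) (beta_rel X A)"
  by (auto simp: beta_rel_def intro!: equivI refl_onI symI transI)

definition gamma ::
  "'a topology \<Rightarrow> ('a \<Rightarrow> 'k::topological_space) set \<Rightarrow> (('a \<Rightarrow> real) \<Rightarrow> real) set topology" where
  "gamma X A = quotient_topology (beta X) (beta_rel X A)"

definition gamma_emb ::
  "'a topology \<Rightarrow> ('a \<Rightarrow> 'k::topological_space) set \<Rightarrow> 'a \<Rightarrow> (('a \<Rightarrow> real) \<Rightarrow> real) set" where
  "gamma_emb X A x = beta_rel X A `` {beta_emb X x}"

definition gamma_ext ::
  "'a topology \<Rightarrow> ('a \<Rightarrow> 'k::topological_space) set \<Rightarrow> ('a \<Rightarrow> 'k) \<Rightarrow>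
     (('a \<Rightarrow> real) \<Rightarrow> real) set \<Rightarrow> 'k option" where
  "gamma_ext X A f = extension (gamma X A) (gamma_emb X A) X f"


section \<open>Strong regularity, compatibility, biseparating maps\<close>

definition strongly_regular :: "'a topology \<Rightarrow> ('a \<Rightarrow> 'k::real_or_complex) set \<Rightarrow> bool" where
  "strongly_regular X A \<longleftrightarrow>
     function_subring X A \<and> separates_points_from_beta X A \<and>
     (\<forall>c\<in>topspace (gamma X A). \<forall>K. closedin (gamma X A) K \<and> K \<noteq> {} \<and> c \<notin> K \<longrightarrow>
        (\<exists>f\<in>A. (\<exists>U. openin (gamma X A) U \<and> c \<in> U \<and> (\<forall>u\<in>U. gamma_ext X A f u = Some 1)) \<and>
               (\<forall>u\<in>K. gamma_ext X A f u = Some 0)))"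

definition compatible ::
  "'a topology \<Rightarrow> ('k \<Rightarrow> 'e \<Rightarrow> 'e) \<Rightarrow> ('a \<Rightarrow> 'k::real_or_complex) set \<Rightarrow>
     ('a \<Rightarrow> 'e::real_normed_vector) set \<Rightarrow> bool" where
  "compatible X sc A M \<longleftrightarrow>
     function_module X sc A M \<and>
     (\<forall>x\<in>topspace X. \<exists>f\<in>M. f x \<noteq> 0) \<and>
     (\<forall>(p, q)\<in>beta_rel X A. \<forall>f\<in>M. norm_beta_ext X f p = norm_beta_ext X f q)"

text \<open>The conditions that Situation 1 imposes on each of the two pairs; the premise of the last one
  says that \<open>\<gamma>X \<noteq> \<beta>X\<close>.\<close>

definition situation1 ::
  "'a topology \<Rightarrow> ('k \<Rightarrow> 'e \<Rightarrow> 'e) \<Rightarrow> ('a \<Rightarrow> 'k::real_or_complex) set \<Rightarrow>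
     ('a \<Rightarrow> 'e::real_normed_vector) set \<Rightarrow> bool" where
  "situation1 X sc A M \<longleftrightarrow>
     strongly_regular X A \<and> compatible X sc A M \<and>
     (beta_rel X A \<noteq> Id_on (topspace (beta X)) \<longrightarrow>
        (\<forall>p\<in>topspace (beta X). \<exists>f\<in>M. norm_beta_ext X f p \<noteq> Some 0))"

definition separating ::
  "'a topology \<Rightarrow> 'b topology \<Rightarrow> ('a \<Rightarrow> 'e::ab_group_add) set \<Rightarrow> ('b \<Rightarrow> 'f::ab_group_add) set \<Rightarrow>
     (('a \<Rightarrow> 'e) \<Rightarrow> 'b \<Rightarrow> 'f) \<Rightarrow> bool" where
  "separating X Y M N T \<longleftrightarrow>
     T ` M \<subseteq> N \<and>
     (\<forall>f\<in>M. \<forall>g\<in>M. T (\<lambda>x. f x + g x) = (\<lambda>y. T f y + T g y)) \<and>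
     (\<forall>f\<in>M. \<forall>g\<in>M. cozero X f \<inter> cozero X g = {} \<longrightarrow> cozero Y (T f) \<inter> cozero Y (T g) = {})"

definition biseparating ::
  "'a topology \<Rightarrow> 'b topology \<Rightarrow> ('a \<Rightarrow> 'e::ab_group_add) set \<Rightarrow> ('b \<Rightarrow> 'f::ab_group_add) set \<Rightarrow>
     (('a \<Rightarrow> 'e) \<Rightarrow> 'b \<Rightarrow> 'f) \<Rightarrow> bool" where
  "biseparating X Y M N T \<longleftrightarrow>
     bij_betw T M N \<and> separating X Y M N T \<and> separating Y X N M (inv_into M T)"

end

theory Submission
  imports Defs
begin

text \<open>
  A point \<open>p\<close> of \<open>\<gamma>X\<close> is associated with a point \<open>q\<close> of \<open>\<gamma>Y\<close> if for all neighbourhoods \<open>U\<close> of \<open>p\<close> and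
  \<open>V\<close> of \<open>q\<close> there is a nonzero \<open>f\<close> with \<open>c(f)\<close> in \<open>U\<close> and \<open>c(Tf)\<close> in \<open>V\<close>. This relation is closed, and
  compactness makes it total in both directions. It is also single-valued: if \<open>q\<close> and \<open>q'\<close> were both
  associated with \<open>p\<close>, cut \<open>Th\<close> to \<open>Th\<close> near \<open>q\<close> and to \<open>0\<close> near \<open>q'\<close>; the preimage of the cut function
  agrees with \<open>h\<close> at points accumulating at \<open>p\<close> and vanishes at other such points, which is impossible
  if \<open>\<parallel>h\<parallel>\<close> does not vanish at \<open>p\<close>. Such an \<open>h\<close> exists for all \<open>p\<close> if \<open>\<gamma>X \<noteq> \<beta>X\<close>, and for \<open>p\<close> in \<open>X\<close>
  always; if \<open>\<gamma>X = \<beta>X\<close> the remaining points follow from the extension property of \<open>\<beta>X\<close>. A closed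
  relation that is the graph of a bijection between compact Hausdorff spaces is a homeomorphism.
\<close>


section \<open>Closed relations and separation in compact Hausdorff spaces\<close>

text \<open>Projecting along the compact factor \<open>W\<close> is a closed map, so the preimage of
  a closed \<open>C\<close>, being the projection of \<open>R\<close> restricted to values in
  \<open>C\<close>, is closed. This closed graph principle produces both the homeomorphism at the
  end and the extensions to \<beta>X.\<close>

lemma single_valued_closed_relation_continuous:
  assumes W: "compact_space W" and R: "closedin (prod_topology Z W) R"
    and total: "\<And>p. p \<in> topspace Z \<Longrightarrow> \<exists>q. (p, q) \<in> R"
    and single: "\<And>p q q'. (p, q) \<in> R \<Longrightarrow> (p, q') \<in> R \<Longrightarrow> q = q'"
  shows "\<exists>f. continuous_map Z W f \<and> (\<forall>p q. (p, q) \<in> R \<longleftrightarrow> p \<in> topspace Z \<and> q = f p)"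
proof -
  define f where "f p = (THE q. (p, q) \<in> R)" for p
  have RZW: "R \<subseteq> topspace Z \<times> topspace W"
    using closedin_subset[OF R] by simp
  have f: "(p, q) \<in> R \<longleftrightarrow> p \<in> topspace Z \<and> q = f p" for p q
  proof -
    have "(p, f p) \<in> R" if "p \<in> topspace Z"
    proof -
      have "\<exists>!q. (p, q) \<in> R" using total[OF that] single by blast
      then show ?thesis unfolding f_def by (rule theI')
    qed
    then show ?thesis using single RZW by blast
  qed
  have "continuous_map Z W f"
    unfolding continuous_map_closedin
  proof (intro conjI Pi_I allI impI)
    fix p assume "p \<in> topspace Z"
    then show "f p \<in> topspace W" using f RZW by blast
  next
    fix C assume C: "closedin W C"
    have "closedin (prod_topology Z W) (R \<inter> topspace Z \<times> C)"
      using R C by (simp add: closedin_Int closedin_prod_Times_iff)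
    then have "closedin Z (fst ` (R \<inter> topspace Z \<times> C))"
      using Abstract_Topological_Spaces.closed_map_fst[OF W] by (auto simp: closed_map_def)
    also have "fst ` (R \<inter> topspace Z \<times> C) = {x \<in> topspace Z. f x \<in> C}"
      using f by force
    finally show "closedin Z {x \<in> topspace Z. f x \<in> C}" .
  qed
  then show ?thesis using f by blast
qed

text \<open>Disjointness of the closures, and not just of the open sets, is what allows
  \<open>cut\<close> and Urysohn functions to be applied to the pair.\<close>

lemma Hausdorff_regular_separation:
  assumes "compact_space W" "Hausdorff_space W" "q \<in> topspace W" "q' \<in> topspace W" "q \<noteq> q'"
  obtains V V' where "openin W V" "openin W V'" "q \<in> V" "q' \<in> V'"
    "W closure_of V \<inter> W closure_of V' = {}"
proof -
  have "normal_space W" "closedin W {q}" "closedin W {q'}"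
    using assms by (auto simp: compact_Hausdorff_or_regular_imp_normal_space closedin_Hausdorff_sing_eq)
  moreover have "disjnt {q} {q'}" using assms(5) by simp
  ultimately have "\<exists>V V'. openin W V \<and> openin W V' \<and> {q} \<subseteq> V \<and> {q'} \<subseteq> V' \<and>
      disjnt (W closure_of V) (W closure_of V')"
    unfolding normal_space_disjoint_closures by blast
  then show thesis
    using that unfolding disjnt_def by blast
qed

lemma compact_Hausdorff_Urysohn:
  assumes "compact_space W" "Hausdorff_space W" "closedin W K" "closedin W K'" "K \<inter> K' = {}"
  obtains u :: "_ \<Rightarrow> real" where "continuous_map W (top_of_set {0..1}) u"
    "u ` K \<subseteq> {0}" "u ` K' \<subseteq> {1}"
proof -
  have "normal_space W"
    using assms compact_Hausdorff_or_regular_imp_normal_space by blast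
  then show thesis
    using Urysohn_lemma[of W K K' 0 1] assms that by (auto simp: disjnt_def)
qed

section \<open>Cozero sets and additive groups of functions\<close>

lemma cozero_iff [simp]: "x \<in> cozero X f \<longleftrightarrow> x \<in> topspace X \<and> f x \<noteq> 0"
  by (simp add: cozero_def)

lemma openin_cozero:
  assumes "f \<in> C_space X"
  shows "openin X (cozero X f)"
proof -
  have "openin X {x \<in> topspace X. f x \<in> - {0}}"
    using assms by (intro openin_continuous_map_preimage[where Y = euclidean]) (auto simp: C_space_def)
  then show ?thesis by (simp add: cozero_def)
qed

lemma additive_subgroup_diff:
  "additive_subgroup M \<Longrightarrow> f \<in> M \<Longrightarrow> g \<in> M \<Longrightarrow> (\<lambda>x. f x - g x) \<in> M"
  by (simp add: additive_subgroup_def)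

lemma additive_subgroup_add:
  assumes "additive_subgroup M" "f \<in> M" "g \<in> M"
  shows "(\<lambda>x. f x + g x) \<in> M"
proof -
  have "(\<lambda>x. 0 - g x) \<in> M"
    using assms additive_subgroup_diff[of M "\<lambda>x. 0" g] by (simp add: additive_subgroup_def)
  from additive_subgroup_diff[OF assms(1,2) this] have "(\<lambda>x. f x - (0 - g x)) \<in> M" .
  then show ?thesis by simp
qed

text \<open>This holds if \<open>\<parallel>h\<parallel>\<close> extends to a function not vanishing at \<open>p\<close> for some \<open>h\<close>; stated without
  norms, so that no extension of \<open>\<parallel>h\<parallel>\<close> is needed in the abstract argument.\<close>

definition visible ::
  "'z topology \<Rightarrow> ('a \<Rightarrow> 'z) \<Rightarrow> 'a topology \<Rightarrow> ('a \<Rightarrow> 'v::zero) set \<Rightarrow> 'z \<Rightarrow> bool" where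
  "visible Z j X M p \<longleftrightarrow>
     (\<exists>h\<in>M. \<forall>k\<in>M. \<not> (p \<in> Z closure_of (j ` {x \<in> topspace X. k x = h x}) \<and>
                        p \<in> Z closure_of (j ` {x \<in> topspace X. k x = 0})))"

section \<open>Compactifications with enough functions, in abstract form\<close>

text \<open>The ring has disappeared: \<open>local\<close> and \<open>cut\<close> record what
  multiplication by its elements achieves. The two alternatives of \<open>visible_or_extend\<close>
  reflect the two cases of Situation 1, the second one being the extension property of \<beta>X for
  functions into the unit interval.\<close>

locale function_compactification =
  fixes X :: "'a topology" and Z :: "'z topology" and j :: "'a \<Rightarrow> 'z"
    and M :: "('a \<Rightarrow> 'v::real_normed_vector) set"
  assumes compact: "compact_space Z" and Hausdorff: "Hausdorff_space Z"
    and emb: "embedding_map X Z j"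
    and dense: "Z closure_of (j ` topspace X) = topspace Z"
    and M_cont: "M \<subseteq> C_space X" and M_add: "additive_subgroup M"
    and local: "\<And>x U. x \<in> topspace X \<Longrightarrow> openin Z U \<Longrightarrow> j x \<in> U \<Longrightarrow>
                  \<exists>f\<in>M. f x \<noteq> 0 \<and> j ` cozero X f \<subseteq> U"
    and cut: "\<And>h K K'. h \<in> M \<Longrightarrow> closedin Z K \<Longrightarrow> closedin Z K' \<Longrightarrow> K \<inter> K' = {} \<Longrightarrow>
                \<exists>k\<in>M. \<forall>x\<in>topspace X. (j x \<in> K \<longrightarrow> k x = h x) \<and> (j x \<in> K' \<longrightarrow> k x = 0)"
    and visible_or_extend: "(\<forall>p\<in>topspace Z. visible Z j X M p) \<or>
      (\<forall>u. continuous_map X (top_of_set {0..1::real}) u \<longrightarrow>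
         (\<exists>w. continuous_map Z euclideanreal w \<and> (\<forall>x\<in>topspace X. w (j x) = u x)))"
begin

lemma j_cont: "continuous_map X Z j"
  using emb continuous_map_in_subtopology embedding_map_def homeomorphic_imp_continuous_map by blast

lemma j_in: "x \<in> topspace X \<Longrightarrow> j x \<in> topspace Z"
  using continuous_map_image_subset_topspace[OF j_cont] by blast

lemma trace:
  assumes "openin X O'"
  obtains U where "openin Z U" "\<And>x. x \<in> topspace X \<Longrightarrow> j x \<in> U \<longleftrightarrow> x \<in> O'"
proof -
  have h: "homeomorphic_map X (subtopology Z (j ` topspace X)) j"
    using emb by (simp add: embedding_map_def)
  then have "openin (subtopology Z (j ` topspace X)) (j ` O')"
    using assms homeomorphic_map_openness_eq by blast
  then obtain U where U: "openin Z U" "j ` O' = U \<inter> j ` topspace X"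
    by (auto simp: openin_subtopology)
  have "inj_on j (topspace X)"
    using h homeomorphic_imp_injective_map by blast
  then have "j x \<in> U \<longleftrightarrow> x \<in> O'" if "x \<in> topspace X" for x
    using U(2) that openin_subset[OF assms] by (auto dest: inj_onD)
  then show thesis using that U(1) by blast
qed

lemma dense_open:
  assumes "openin Z U" "p \<in> U"
  obtains x where "x \<in> topspace X" "j x \<in> U"
proof -
  have "p \<in> Z closure_of (j ` topspace X)"
    using dense assms openin_subset by blast
  then show thesis using assms that by (auto simp: in_closure_of)
qed

text \<open>As \<open>j\<close> is an embedding, the complement of \<open>S\<close> is the trace of
  an open set of \<open>Z\<close>, and this open set misses the image of \<open>S\<close>.\<close>

lemma closure_closed_set:
  assumes "closedin X S" "x \<in> topspace X" "j x \<in> Z closure_of (j ` S)"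
  shows "x \<in> S"
proof (rule ccontr)
  assume "x \<notin> S"
  obtain U where U: "openin Z U" "\<And>x. x \<in> topspace X \<Longrightarrow> j x \<in> U \<longleftrightarrow> x \<in> topspace X - S"
    using trace[of "topspace X - S"] assms(1) by blast
  then have "j x \<in> U" using \<open>x \<notin> S\<close> assms(2) by auto
  then obtain s where "s \<in> S" "j s \<in> U"
    using assms(3) U(1) by (auto simp: in_closure_of)
  then show False using U(2)[of s] assms(1) closedin_subset by blast
qed

text \<open>Any \<open>h\<close> with \<open>h x \<noteq> 0\<close> will do. The sets where
  \<open>k = h\<close> and where \<open>k = 0\<close> are closed in \<open>X\<close>, so if
  \<open>j x\<close> were in both closures, \<open>x\<close> itself would satisfy both
  equations.\<close>

lemma visible_embedding:
  assumes "x \<in> topspace X"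
  shows "visible Z j X M (j x)"
proof -
  obtain h where h: "h \<in> M" "h x \<noteq> 0"
    using local[OF assms openin_topspace j_in[OF assms]] by blast
  have "\<not> (j x \<in> Z closure_of (j ` {x \<in> topspace X. k x = h x}) \<and>
           j x \<in> Z closure_of (j ` {x \<in> topspace X. k x = 0}))" if "k \<in> M" for k
  proof -
    have c: "continuous_map X euclidean k" "continuous_map X euclidean h"
      using that h M_cont by (auto simp: C_space_def)
    have "closedin X {x \<in> topspace X. k x = h x}"
      by (rule closedin_continuous_maps_eq[OF _ c]) simp
    moreover have "closedin X {x \<in> topspace X. k x = 0}"
      by (rule closedin_continuous_maps_eq[OF _ c(1)]) simp_all
    ultimately show ?thesis
      using closure_closed_set[OF _ assms] h(2) by (metis (mono_tags, lifting) mem_Collect_eq)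
  qed
  then show ?thesis unfolding visible_def using h(1) by blast
qed

end

section \<open>Biseparating maps and the association of points\<close>

lemma separatingD:
  assumes "separating X Y M N T"
  shows "f \<in> M \<Longrightarrow> T f \<in> N"
    and "f \<in> M \<Longrightarrow> g \<in> M \<Longrightarrow> T (\<lambda>x. f x + g x) = (\<lambda>y. T f y + T g y)"
    and "f \<in> M \<Longrightarrow> g \<in> M \<Longrightarrow> cozero X f \<inter> cozero X g = {} \<Longrightarrow> cozero Y (T f) \<inter> cozero Y (T g) = {}"
  using assms unfolding separating_def by (blast, meson, meson)

text \<open>The inverse is a parameter \<open>S\<close> of its own, inverse to \<open>T\<close> only
  on \<open>M\<close> and \<open>N\<close>. This makes the assumptions symmetric, so that
  \<open>swap\<close> yields each result for the opposite direction as well.\<close>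

locale biseparating_pair =
  dom: function_compactification X Z j M + cod: function_compactification Y W i N
  for X :: "'a topology" and Z :: "'z topology" and j :: "'a \<Rightarrow> 'z"
    and M :: "('a \<Rightarrow> 'v::real_normed_vector) set"
    and Y :: "'b topology" and W :: "'w topology" and i :: "'b \<Rightarrow> 'w"
    and N :: "('b \<Rightarrow> 'u::real_normed_vector) set" +
  fixes T :: "('a \<Rightarrow> 'v) \<Rightarrow> 'b \<Rightarrow> 'u" and S :: "('b \<Rightarrow> 'u) \<Rightarrow> 'a \<Rightarrow> 'v"
  assumes T_sep: "separating X Y M N T" and S_sep: "separating Y X N M S"
    and ST: "\<And>f. f \<in> M \<Longrightarrow> S (T f) = f" and TS: "\<And>g. g \<in> N \<Longrightarrow> T (S g) = g"
begin

lemma swap: "biseparating_pair Y W i N X Z j M S T"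
  by unfold_locales (fact T_sep S_sep ST TS)+

lemma T_in: "f \<in> M \<Longrightarrow> T f \<in> N" and S_in: "g \<in> N \<Longrightarrow> S g \<in> M"
  using separatingD(1) T_sep S_sep by blast+

lemma disjoint_iff:
  assumes "f \<in> M" "g \<in> M"
  shows "cozero Y (T f) \<inter> cozero Y (T g) = {} \<longleftrightarrow> cozero X f \<inter> cozero X g = {}"
proof
  assume "cozero X f \<inter> cozero X g = {}"
  then show "cozero Y (T f) \<inter> cozero Y (T g) = {}"
    using separatingD(3)[OF T_sep assms] by blast
next
  assume "cozero Y (T f) \<inter> cozero Y (T g) = {}"
  then show "cozero X f \<inter> cozero X g = {}"
    using separatingD(3)[OF S_sep T_in[OF assms(1)] T_in[OF assms(2)]] ST assms by simp
qed

lemma T_diff: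
  assumes "f \<in> M" "g \<in> M"
  shows "T (\<lambda>x. f x - g x) = (\<lambda>y. T f y - T g y)"
proof -
  have "T (\<lambda>x. (f x - g x) + g x) = (\<lambda>y. T (\<lambda>x. f x - g x) y + T g y)"
    by (rule separatingD(2)[OF T_sep additive_subgroup_diff[OF dom.M_add assms] assms(2)])
  then show ?thesis by (simp add: fun_eq_iff)
qed

definition assoc :: "'z \<Rightarrow> 'w \<Rightarrow> bool" where
  "assoc p q \<longleftrightarrow> p \<in> topspace Z \<and> q \<in> topspace W \<and>
     (\<forall>U V. openin Z U \<longrightarrow> openin W V \<longrightarrow> p \<in> U \<longrightarrow> q \<in> V \<longrightarrow>
        (\<exists>f\<in>M. cozero X f \<noteq> {} \<and> j ` cozero X f \<subseteq> U \<and> i ` cozero Y (T f) \<subseteq> V))"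

lemma T_cozero_nonempty: "f \<in> M \<Longrightarrow> cozero Y (T f) \<noteq> {} \<longleftrightarrow> cozero X f \<noteq> {}"
  using disjoint_iff[of f f] by simp

text \<open>A witness \<open>f\<close> on one side becomes the witness \<open>T f\<close> on the
  other, and \<open>g\<close> becomes \<open>S g\<close>; neither map sends a nonzero function to
  zero.\<close>

lemma assoc_swap: "assoc p q \<longleftrightarrow> biseparating_pair.assoc Y W i N X Z j S q p"
proof -
  have *: "(\<exists>f\<in>M. cozero X f \<noteq> {} \<and> j ` cozero X f \<subseteq> U \<and> i ` cozero Y (T f) \<subseteq> V) \<longleftrightarrow>
    (\<exists>g\<in>N. cozero Y g \<noteq> {} \<and> i ` cozero Y g \<subseteq> V \<and> j ` cozero X (S g) \<subseteq> U)" for U V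
  proof
    assume "\<exists>f\<in>M. cozero X f \<noteq> {} \<and> j ` cozero X f \<subseteq> U \<and> i ` cozero Y (T f) \<subseteq> V"
    then obtain f where "f \<in> M" "cozero X f \<noteq> {}" "j ` cozero X f \<subseteq> U" "i ` cozero Y (T f) \<subseteq> V"
      by blast
    then show "\<exists>g\<in>N. cozero Y g \<noteq> {} \<and> i ` cozero Y g \<subseteq> V \<and> j ` cozero X (S g) \<subseteq> U"
      using T_in[of f] ST[of f] T_cozero_nonempty[of f] by (intro bexI[of _ "T f"]) auto
  next
    assume "\<exists>g\<in>N. cozero Y g \<noteq> {} \<and> i ` cozero Y g \<subseteq> V \<and> j ` cozero X (S g) \<subseteq> U"
    then obtain g where "g \<in> N" "cozero Y g \<noteq> {}" "i ` cozero Y g \<subseteq> V" "j ` cozero X (S g) \<subseteq> U"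
      by blast
    then show "\<exists>f\<in>M. cozero X f \<noteq> {} \<and> j ` cozero X f \<subseteq> U \<and> i ` cozero Y (T f) \<subseteq> V"
      using S_in[of g] TS[of g] T_cozero_nonempty[of "S g"] by (intro bexI[of _ "S g"]) auto
  qed
  show ?thesis
    unfolding assoc_def biseparating_pair.assoc_def[OF swap] * by blast
qed

text \<open>If \<open>U\<close> and \<open>V\<close> admit no witness \<open>f\<close>, then no
  point of \<open>U \<times> V\<close> is an associated pair.\<close>

lemma closedin_assoc: "closedin (prod_topology Z W) {(p, q). assoc p q}"
proof -
  have "\<exists>N. openin (prod_topology Z W) N \<and> r \<in> N \<and> N \<subseteq> topspace (prod_topology Z W) - {(p, q). assoc p q}"
    if r: "r \<in> topspace (prod_topology Z W) - {(p, q). assoc p q}" for r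
  proof -
    obtain p q where pq: "r = (p, q)" "p \<in> topspace Z" "q \<in> topspace W" "\<not> assoc p q"
      using r by auto
    then obtain U V where UV: "openin Z U" "openin W V" "p \<in> U" "q \<in> V"
      "\<not> (\<exists>f\<in>M. cozero X f \<noteq> {} \<and> j ` cozero X f \<subseteq> U \<and> i ` cozero Y (T f) \<subseteq> V)"
      unfolding assoc_def by blast
    then have "U \<times> V \<subseteq> topspace (prod_topology Z W) - {(p, q). assoc p q}"
      using openin_subset[OF UV(1)] openin_subset[OF UV(2)] UV unfolding assoc_def topspace_prod_topology
      by blast
    moreover have "openin (prod_topology Z W) (U \<times> V)"
      using UV by (simp add: openin_prod_Times_iff)
    ultimately show ?thesis using pq UV by blast
  qed
  then have "openin (prod_topology Z W) (topspace (prod_topology Z W) - {(p, q). assoc p q})"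
    by (subst openin_subopen) blast
  then show ?thesis
    by (auto simp: closedin_def assoc_def)
qed

text \<open>Otherwise some nonzero \<open>k\<close> disjoint from \<open>f\<close> meets \<open>Sg\<close>, although \<open>Tk\<close> is disjoint from \<open>Tf\<close>
  and hence from \<open>g\<close>.\<close>

lemma preimage_support:
  assumes f: "f \<in> M" and g: "g \<in> N" "cozero Y g \<subseteq> cozero Y (T f)"
  shows "j ` cozero X (S g) \<subseteq> Z closure_of (j ` cozero X f)"
proof (rule ccontr)
  assume "\<not> ?thesis"
  then obtain x where x: "x \<in> cozero X (S g)" "j x \<notin> Z closure_of (j ` cozero X f)" by blast
  have "openin Z (topspace Z - Z closure_of (j ` cozero X f))" by (simp add: openin_diff)
  then obtain k where k: "k \<in> M" "k x \<noteq> 0" "j ` cozero X k \<subseteq> topspace Z - Z closure_of (j ` cozero X f)"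
    using dom.local[of x "topspace Z - Z closure_of (j ` cozero X f)"] x dom.j_in by auto
  have "j ` cozero X f \<subseteq> Z closure_of (j ` cozero X f)"
    using dom.j_in by (intro closure_of_subset) auto
  then have "cozero X k \<inter> cozero X f = {}"
    using k(3) by blast
  then have "cozero Y (T k) \<inter> cozero Y (T f) = {}"
    using disjoint_iff k(1) f by blast
  then have "cozero Y (T k) \<inter> cozero Y (T (S g)) = {}"
    using g TS by auto
  then have "cozero X k \<inter> cozero X (S g) = {}"
    using disjoint_iff k(1) S_in g(1) by blast
  then show False using x k(2) by auto
qed

text \<open>Otherwise each \<open>q\<close> has a neighbourhood \<open>V q\<close> that admits no
  witness together with some neighbourhood \<open>U q\<close> of \<open>p\<close>. Finitely many
  \<open>V q\<close> cover \<open>W\<close>. A nonzero \<open>f\<close> living inside the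
  corresponding finite intersection of the \<open>U q\<close> has \<open>T f\<close> nonzero
  somewhere in one \<open>V q\<close>; a function \<open>g\<close> supported there and inside
  \<open>cozero Y (T f)\<close> gives the forbidden witness \<open>S g\<close>.\<close>

lemma assoc_total:
  assumes p: "p \<in> topspace Z"
  shows "\<exists>q. assoc p q"
proof (rule ccontr)
  assume no: "\<nexists>q. assoc p q"
  define good where "good U V \<longleftrightarrow> (\<exists>f\<in>M. cozero X f \<noteq> {} \<and> j ` cozero X f \<subseteq> U \<and> i ` cozero Y (T f) \<subseteq> V)"
    for U V
  have "\<exists>U V. openin Z U \<and> openin W V \<and> p \<in> U \<and> q \<in> V \<and> \<not> good U V" if "q \<in> topspace W" for q
  proof -
    have "\<not> assoc p q" using no by simp
    then show ?thesis
      using p that unfolding assoc_def good_def[symmetric] by blast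
  qed
  then obtain U V where opU: "\<And>q. q \<in> topspace W \<Longrightarrow> openin Z (U q)"
    and opV: "\<And>q. q \<in> topspace W \<Longrightarrow> openin W (V q)"
    and pU: "\<And>q. q \<in> topspace W \<Longrightarrow> p \<in> U q" and qV: "\<And>q. q \<in> topspace W \<Longrightarrow> q \<in> V q"
    and bad: "\<And>q. q \<in> topspace W \<Longrightarrow> \<not> good (U q) (V q)"
    by metis
  have "\<exists>Q. finite Q \<and> Q \<subseteq> topspace W \<and> topspace W \<subseteq> \<Union>(V ` Q)"
  proof -
    have "\<forall>P\<in>V ` topspace W. openin W P" "topspace W \<subseteq> \<Union>(V ` topspace W)"
      using opV qV by blast+
    then obtain F where "finite F" "F \<subseteq> V ` topspace W" "topspace W \<subseteq> \<Union>F"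
      using cod.compact unfolding compact_space_alt by meson
    then show ?thesis using finite_subset_image by metis
  qed
  then obtain Q where Q: "finite Q" "Q \<subseteq> topspace W" "topspace W \<subseteq> \<Union>(V ` Q)" by blast
  \<comment> \<open>Intersecting with \<open>topspace Z\<close> covers the case of empty
    \<open>Q\<close>, where the intersection of the family alone would be
    \<open>UNIV\<close>.\<close>
  define U' where "U' = topspace Z \<inter> \<Inter>(U ` Q)"
  have "openin Z U'"
    unfolding U'_def using Q opU by (cases "Q = {}") (auto intro!: openin_Int openin_Inter)
  moreover have "p \<in> U'" using p pU Q by (auto simp: U'_def)
  \<comment> \<open>A closed set \<open>C\<close> is inserted between \<open>O'\<close> and
    \<open>U'\<close> because \<open>preimage_support\<close> bounds the support of
    \<open>S g\<close> only by the closure of that of \<open>f\<close>.\<close>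
  moreover have "regular_space Z"
    using dom.compact dom.Hausdorff compact_Hausdorff_imp_regular_space by blast
  ultimately have "\<exists>O' C. openin Z O' \<and> closedin Z C \<and> p \<in> O' \<and> O' \<subseteq> C \<and> C \<subseteq> U'"
    unfolding neighbourhood_base_of_closedin[symmetric] neighbourhood_base_of by blast
  then obtain O' C where OC: "openin Z O'" "closedin Z C" "p \<in> O'" "O' \<subseteq> C" "C \<subseteq> U'"
    by blast
  obtain x where x: "x \<in> topspace X" "j x \<in> O'"
    using dom.dense_open OC by blast
  then obtain f where f: "f \<in> M" "f x \<noteq> 0" "j ` cozero X f \<subseteq> O'"
    using dom.local OC(1) by blast
  have "Z closure_of (j ` cozero X f) \<subseteq> C"
    using f(3) OC by (intro closure_of_minimal) auto
  then have clU: "Z closure_of (j ` cozero X f) \<subseteq> U'"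
    using OC by blast
  have "cozero Y (T f) \<noteq> {}"
    using T_cozero_nonempty f(1,2) x(1) by auto
  then obtain y where y: "y \<in> topspace Y" "T f y \<noteq> 0" by auto
  obtain q where q: "q \<in> Q" "i y \<in> V q"
    using Q(3) cod.j_in y(1) by blast
  \<comment> \<open>\<open>P\<close> expresses \<open>cozero Y (T f)\<close> by an open set of
    \<open>W\<close>, so that \<open>local\<close> can place \<open>g\<close> inside it and inside
    \<open>V q\<close> at once.\<close>
  obtain P where P: "openin W P" "\<And>y. y \<in> topspace Y \<Longrightarrow> i y \<in> P \<longleftrightarrow> y \<in> cozero Y (T f)"
    using cod.trace[OF openin_cozero[of "T f"]] T_in[OF f(1)] cod.M_cont by blast
  have "openin W (V q \<inter> P)" "i y \<in> V q \<inter> P"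
    using q y P opV Q(2) by (auto intro!: openin_Int)
  then obtain g where g: "g \<in> N" "g y \<noteq> 0" "i ` cozero Y g \<subseteq> V q \<inter> P"
    using cod.local[OF y(1)] by blast
  have "cozero Y g \<subseteq> cozero Y (T f)"
    using g(3) P(2) by fastforce
  then have "j ` cozero X (S g) \<subseteq> Z closure_of (j ` cozero X f)"
    using preimage_support f(1) g(1) by blast
  then have "j ` cozero X (S g) \<subseteq> U q"
    using clU q(1) by (auto simp: U'_def)
  moreover have "i ` cozero Y (T (S g)) \<subseteq> V q" using g TS by auto
  moreover have "cozero X (S g) \<noteq> {}"
    using T_cozero_nonempty[OF S_in[OF g(1)]] TS[OF g(1)] g(2) y(1) by auto
  ultimately show False
    using bad[of q] q(1) Q(2) S_in[OF g(1)] unfolding good_def by blast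
qed

text \<open>Otherwise association provides a nonzero \<open>g\<close> supported in \<open>O'\<close>
  with \<open>T g\<close> supported off that closure. Then \<open>T f\<close> and \<open>T g\<close>
  are disjoint, hence so are \<open>f\<close> and \<open>g\<close>, although
  \<open>cozero X g\<close> lies inside \<open>cozero X f\<close>.\<close>

lemma assoc_closure:
  assumes pq: "assoc p q" and f: "f \<in> M" and O': "openin Z O'" "p \<in> O'"
    and sub: "\<And>x. x \<in> topspace X \<Longrightarrow> j x \<in> O' \<Longrightarrow> f x \<noteq> 0"
  shows "q \<in> W closure_of (i ` cozero Y (T f))"
proof (rule ccontr)
  assume q: "q \<notin> W closure_of (i ` cozero Y (T f))"
  have "openin W (topspace W - W closure_of (i ` cozero Y (T f)))" by (simp add: openin_diff)
  then obtain g where g: "g \<in> M" "cozero X g \<noteq> {}" "j ` cozero X g \<subseteq> O'"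
    "i ` cozero Y (T g) \<subseteq> topspace W - W closure_of (i ` cozero Y (T f))"
    using pq O' q unfolding assoc_def by (metis DiffI)
  have "i ` cozero Y (T f) \<subseteq> W closure_of (i ` cozero Y (T f))"
    using cod.j_in by (intro closure_of_subset) auto
  then have "cozero Y (T f) \<inter> cozero Y (T g) = {}"
    using g(4) by blast
  then have "cozero X f \<inter> cozero X g = {}"
    using disjoint_iff f g(1) by blast
  moreover have "cozero X g \<subseteq> cozero X f"
    using g(3) sub by (auto simp: image_subset_iff)
  ultimately show False using g(2) by blast
qed

lemma assoc_single_visible:
  assumes vis: "visible Z j X M p" and q: "assoc p q" and q': "assoc p q'"
  shows "q = q'"
proof (rule ccontr)
  assume "q \<noteq> q'"
  then obtain V V' where V: "openin W V" "openin W V'" "q \<in> V" "q' \<in> V'"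
    "W closure_of V \<inter> W closure_of V' = {}"
    using Hausdorff_regular_separation[OF cod.compact cod.Hausdorff] q q' unfolding assoc_def by metis
  obtain h where h: "h \<in> M" "\<And>k. k \<in> M \<Longrightarrow> \<not> (p \<in> Z closure_of (j ` {x \<in> topspace X. k x = h x}) \<and>
                        p \<in> Z closure_of (j ` {x \<in> topspace X. k x = 0}))"
    using vis unfolding visible_def by blast
  obtain k' where k': "k' \<in> N" "\<And>y. y \<in> topspace Y \<Longrightarrow> i y \<in> W closure_of V \<Longrightarrow> k' y = T h y"
      "\<And>y. y \<in> topspace Y \<Longrightarrow> i y \<in> W closure_of V' \<Longrightarrow> k' y = 0"
    using cod.cut[OF T_in[OF h(1)] _ _ V(5)] by (meson closedin_closure_of)
  have VV: "V \<subseteq> W closure_of V" "V' \<subseteq> W closure_of V'"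
    using V closure_of_subset openin_subset by metis+
  \<comment> \<open>\<open>k\<close> is the preimage of \<open>T h\<close> cut down: it will agree
    with \<open>h\<close> on supports witnessing the pair \<open>(p, q)\<close> and vanish on those
    witnessing \<open>(p, q')\<close>.\<close>
  define k where "k = S k'"
  have k: "k \<in> M" "T k = k'" using k' S_in TS by (auto simp: k_def)
  have p: "p \<in> topspace Z" using q by (simp add: assoc_def)
  have "p \<in> Z closure_of (j ` {x \<in> topspace X. k x = h x})"
    unfolding in_closure_of
  proof (intro conjI p allI impI)
    fix U assume "p \<in> U \<and> openin Z U"
    then obtain f where f: "f \<in> M" "cozero X f \<noteq> {}" "j ` cozero X f \<subseteq> U" "i ` cozero Y (T f) \<subseteq> V"
      using q V unfolding assoc_def by metis
    \<comment> \<open>Additivity turns \<open>T (h - k)\<close> into \<open>T h - k'\<close>, which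
      vanishes over \<open>V\<close>. Disjointness is then pulled back, so \<open>k = h\<close> on
      the nonempty set \<open>cozero X f\<close>, whose image lies in \<open>U\<close>.\<close>
    have "cozero Y (T (\<lambda>x. h x - k x)) \<inter> cozero Y (T f) = {}"
    proof -
      have "k' y = T h y" if "y \<in> cozero Y (T f)" for y
      proof -
        have "i y \<in> W closure_of V" using that f(4) VV(1) by blast
        then show ?thesis using that k'(2) by simp
      qed
      then show ?thesis
        unfolding T_diff[OF h(1) k(1)] k(2) by auto
    qed
    then have "cozero X (\<lambda>x. h x - k x) \<inter> cozero X f = {}"
      using disjoint_iff f(1) additive_subgroup_diff[OF dom.M_add h(1) k(1)] by blast
    then show "\<exists>y. y \<in> j ` {x \<in> topspace X. k x = h x} \<and> y \<in> U"
      using f(2,3) by fastforce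
  qed
  moreover have "p \<in> Z closure_of (j ` {x \<in> topspace X. k x = 0})"
    unfolding in_closure_of
  proof (intro conjI p allI impI)
    fix U assume "p \<in> U \<and> openin Z U"
    then obtain f where f: "f \<in> M" "cozero X f \<noteq> {}" "j ` cozero X f \<subseteq> U" "i ` cozero Y (T f) \<subseteq> V'"
      using q' V unfolding assoc_def by metis
    have "cozero Y (T k) \<inter> cozero Y (T f) = {}"
    proof -
      have "k' y = 0" if "y \<in> cozero Y (T f)" for y
      proof -
        have "i y \<in> W closure_of V'" using that f(4) VV(2) by blast
        then show ?thesis using that k'(3) by simp
      qed
      then show ?thesis
        unfolding k(2) by auto
    qed
    then have "cozero X k \<inter> cozero X f = {}"
      using disjoint_iff f(1) k(1) by blast
    then show "\<exists>y. y \<in> j ` {x \<in> topspace X. k x = 0} \<and> y \<in> U"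
      using f(2,3) by fastforce
  qed
  ultimately show False using h(2)[OF k(1)] by blast
qed

text \<open>At a point that is not visible, a function separating two associated points is pulled back
  to \<open>X\<close> along the association, which is single-valued there, and then extended to \<open>Z\<close>.\<close>

lemma assoc_single:
  assumes q: "assoc p q" and q': "assoc p q'"
  shows "q = q'"
proof (cases "\<forall>p\<in>topspace Z. visible Z j X M p")
  case True
  then show ?thesis using assoc_single_visible[OF _ q q'] q by (simp add: assoc_def)
next
  case False
  show ?thesis
  proof (rule ccontr)
    assume "q \<noteq> q'"
    then obtain V V' where V: "openin W V" "openin W V'" "q \<in> V" "q' \<in> V'"
      "W closure_of V \<inter> W closure_of V' = {}"
      using Hausdorff_regular_separation[OF cod.compact cod.Hausdorff] q q' unfolding assoc_def by metis
    obtain u :: "'w \<Rightarrow> real" where u: "continuous_map W (top_of_set {0..1}) u"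
      "u ` (W closure_of V) \<subseteq> {0}" "u ` (W closure_of V') \<subseteq> {1}"
      using compact_Hausdorff_Urysohn[OF cod.compact cod.Hausdorff _ _ V(5)] by auto
    \<comment> \<open>Points of \<open>X\<close> are always visible, so the association restricted
      to \<open>X\<close> is already known to be single-valued and hence the graph of a continuous
      \<open>\<phi>\<close>.\<close>
    define R where "R = {(x, q). x \<in> topspace X \<and> assoc (j x) q}"
    have R: "closedin (prod_topology X W) R"
    proof -
      have "continuous_map (prod_topology X W) (prod_topology Z W) (\<lambda>r. (j (fst r), snd r))"
        using continuous_map_compose[OF continuous_map_fst dom.j_cont]
        by (auto simp: continuous_map_paired o_def continuous_map_snd)
      from closedin_continuous_map_preimage[OF this closedin_assoc]
      have "closedin (prod_topology X W)
        {r \<in> topspace (prod_topology X W). (j (fst r), snd r) \<in> {(p, q). assoc p q}}" .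
      moreover have "{r \<in> topspace (prod_topology X W). (j (fst r), snd r) \<in> {(p, q). assoc p q}} = R"
        by (auto simp: R_def assoc_def)
      ultimately show ?thesis by simp
    qed
    have "\<exists>\<phi>. continuous_map X W \<phi> \<and> (\<forall>x q. (x, q) \<in> R \<longleftrightarrow> x \<in> topspace X \<and> q = \<phi> x)"
    proof (rule single_valued_closed_relation_continuous[OF cod.compact R])
      show "\<exists>q. (x, q) \<in> R" if "x \<in> topspace X" for x
        using that assoc_total[OF dom.j_in[OF that]] by (auto simp: R_def)
      show "q = q'" if "(x, q) \<in> R" "(x, q') \<in> R" for x q q'
        using that assoc_single_visible dom.visible_embedding by (auto simp: R_def)
    qed
    then obtain \<phi> where \<phi>: "continuous_map X W \<phi>" "\<And>x q. (x, q) \<in> R \<longleftrightarrow> x \<in> topspace X \<and> q = \<phi> x"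
      by blast
    have a: "assoc (j x) (\<phi> x)" if "x \<in> topspace X" for x
      using \<phi>(2)[of x] that by (auto simp: R_def)
    have in_closure: "\<phi> x \<in> W closure_of (i ` cozero Y (T f))" if f: "f \<in> M" "x \<in> cozero X f" for f x
    proof -
      obtain O' where "openin Z O'" "\<And>x. x \<in> topspace X \<Longrightarrow> j x \<in> O' \<longleftrightarrow> x \<in> cozero X f"
        using dom.trace[OF openin_cozero[of f]] dom.M_cont f by blast
      then show ?thesis using assoc_closure[OF a f(1)] f(2) by auto
    qed
    \<comment> \<open>Since some point is not visible, the extension alternative of
      \<open>visible_or_extend\<close> holds and supplies \<open>w\<close>.\<close>
    have "continuous_map X (top_of_set {0..1::real}) (u \<circ> \<phi>)"
      using \<phi>(1) u(1) continuous_map_compose by blast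
    then have "\<exists>w. continuous_map Z euclideanreal w \<and> (\<forall>x\<in>topspace X. w (j x) = (u \<circ> \<phi>) x)"
      using dom.visible_or_extend False by blast
    then obtain w where w: "continuous_map Z euclideanreal w" "\<And>x. x \<in> topspace X \<Longrightarrow> w (j x) = u (\<phi> x)"
      by auto
    \<comment> \<open>If \<open>w p \<noteq> 0\<close>, a witness for \<open>(p, q)\<close> can be
      supported where \<open>w \<noteq> 0\<close>. At a point \<open>x\<close> of its support,
      \<open>\<phi> x\<close> is in the closure of \<open>V\<close>, where \<open>u\<close> is 0, so
      \<open>w (j x) = 0\<close>. The pair \<open>(p, q')\<close> gives \<open>w p = 1\<close> in
      the same way.\<close>
    have "w p = 0"
    proof (rule ccontr)
      assume "w p \<noteq> 0"
      moreover have "openin Z {z \<in> topspace Z. w z \<in> - {0}}"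
        using w(1) by (intro openin_continuous_map_preimage[where Y = euclidean]) auto
      ultimately obtain f where f: "f \<in> M" "cozero X f \<noteq> {}"
        "j ` cozero X f \<subseteq> {z \<in> topspace Z. w z \<in> - {0}}" "i ` cozero Y (T f) \<subseteq> V"
        using q V unfolding assoc_def by (metis (no_types, lifting) mem_Collect_eq ComplI singletonD)
      then obtain x where x: "x \<in> cozero X f" by blast
      have "\<phi> x \<in> W closure_of V"
        using in_closure[OF f(1) x] closure_of_mono[OF f(4)] by blast
      then show False using f(3) x w(2) u(2) by (auto simp: image_subset_iff)
    qed
    moreover have "w p = 1"
    proof (rule ccontr)
      assume "w p \<noteq> 1"
      moreover have "openin Z {z \<in> topspace Z. w z \<in> - {1}}"
        using w(1) by (intro openin_continuous_map_preimage[where Y = euclidean]) auto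
      ultimately obtain f where f: "f \<in> M" "cozero X f \<noteq> {}"
        "j ` cozero X f \<subseteq> {z \<in> topspace Z. w z \<in> - {1}}" "i ` cozero Y (T f) \<subseteq> V'"
        using q' V unfolding assoc_def by (metis (no_types, lifting) mem_Collect_eq ComplI singletonD)
      then obtain x where x: "x \<in> cozero X f" by blast
      have "\<phi> x \<in> W closure_of V'"
        using in_closure[OF f(1) x] closure_of_mono[OF f(4)] by blast
      then show False using f(3) x w(2) u(3) by (auto simp: image_subset_iff)
    qed
    ultimately show False by simp
  qed
qed

text \<open>The association is the graph of a continuous map. Surjectivity and injectivity are
  totality and single-valuedness of the swapped association, and a continuous bijection from a
  compact to a Hausdorff space is a homeomorphism.\<close>

theorem homeomorphic: "Z homeomorphic_space W"
proof -
  interpret s: biseparating_pair Y W i N X Z j M S T by (rule swap)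
  have "\<exists>\<phi>. continuous_map Z W \<phi> \<and>
      (\<forall>p q. (p, q) \<in> {(p, q). assoc p q} \<longleftrightarrow> p \<in> topspace Z \<and> q = \<phi> p)"
    by (rule single_valued_closed_relation_continuous[OF cod.compact closedin_assoc])
      (auto intro: assoc_total assoc_single)
  then obtain \<phi> where \<phi>: "continuous_map Z W \<phi>"
    and a: "\<And>p q. assoc p q \<longleftrightarrow> p \<in> topspace Z \<and> q = \<phi> p"
    by auto
  have "\<phi> ` topspace Z = topspace W"
  proof
    show "\<phi> ` topspace Z \<subseteq> topspace W" using a by (auto simp: assoc_def)
    show "topspace W \<subseteq> \<phi> ` topspace Z" using s.assoc_total assoc_swap a by blast
  qed
  moreover have "inj_on \<phi> (topspace Z)"
    using s.assoc_single assoc_swap a by (metis inj_onI)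
  ultimately show ?thesis
    using continuous_imp_homeomorphic_map[OF \<phi> dom.compact cod.Hausdorff]
    by (meson homeomorphic_map_imp_homeomorphic_space)
qed

end

section \<open>The Stone-Cech compactification and its extension property\<close>

lemma compact_space_beta: "compact_space (beta X)"
proof -
  have "compact_space (product_topology (\<lambda>h. top_of_set {0..1::real}) (unit_functions X))"
    by (simp add: compact_space_product_topology compact_space_subtopology)
  then show ?thesis
    unfolding beta_def Let_def by (intro compact_space_subtopology closedin_compact_space) auto
qed

lemma continuous_map_beta_emb: "continuous_map X (beta X) (beta_emb X)"
proof -
  let ?cube = "product_topology (\<lambda>h. top_of_set {0..1::real}) (unit_functions X)"
  have c: "continuous_map X ?cube (beta_emb X)"
    unfolding continuous_map_componentwise
  proof (intro conjI ballI)
    show "beta_emb X ` topspace X \<subseteq> extensional (unit_functions X)" by (simp add: beta_emb_def image_subset_iff)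
    show "continuous_map X (top_of_set {0..1}) (\<lambda>x. beta_emb X x h)" if "h \<in> unit_functions X" for h
    proof -
      have "(\<lambda>x. beta_emb X x h) = h" using that by (intro ext) (simp add: beta_emb_def)
      moreover have "continuous_map X euclideanreal h" "h ` topspace X \<subseteq> {0..1}"
        using that by (simp_all add: unit_functions_def C_space_def)
      ultimately show ?thesis by (metis continuous_map_into_subtopology image_subset_iff_funcset)
    qed
  qed
  have "beta_emb X ` topspace X \<subseteq> ?cube closure_of (beta_emb X ` topspace X)"
    by (rule closure_of_subset[OF continuous_map_image_subset_topspace[OF c]])
  then have "beta_emb X \<in> topspace X \<rightarrow> ?cube closure_of (beta_emb X ` topspace X)"
    by (simp only: image_subset_iff_funcset)
  then show ?thesis
    unfolding beta_def Let_def by (rule continuous_map_into_subtopology[OF c])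
qed

lemma beta_emb_in: "x \<in> topspace X \<Longrightarrow> beta_emb X x \<in> topspace (beta X)"
  using continuous_map_image_subset_topspace[OF continuous_map_beta_emb[of X]] by (simp add: image_subset_iff)

lemma dense_beta: "beta X closure_of (beta_emb X ` topspace X) = topspace (beta X)"
proof -
  let ?cube = "product_topology (\<lambda>h. top_of_set {0..1::real}) (unit_functions X)"
  let ?S = "beta_emb X ` topspace X"
  have "continuous_map X ?cube (beta_emb X)"
    using continuous_map_beta_emb[of X] unfolding beta_def Let_def
    by (rule continuous_map_into_fulltopology)
  from closure_of_subset[OF continuous_map_image_subset_topspace[OF this]]
  have "?S \<subseteq> ?cube closure_of ?S" .
  then have "?cube closure_of ?S \<inter> ?S = ?S" by blast
  moreover have "topspace ?cube \<inter> ?cube closure_of ?S = ?cube closure_of ?S"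
    using closure_of_subset_topspace[of ?cube ?S] by (rule inf.absorb2)
  ultimately show ?thesis
    unfolding beta_def Let_def by (simp only: closure_of_subtopology topspace_subtopology Int_absorb)
qed

text \<open>The extension is a coordinate projection of the cube, namely evaluation at the
  representative \<open>h\<close> of \<open>u\<close> that vanishes off \<open>X\<close>.\<close>

lemma beta_extend_unit:
  assumes u: "continuous_map X (top_of_set {0..1::real}) u"
  shows "\<exists>w. continuous_map (beta X) euclideanreal w \<and> (\<forall>x\<in>topspace X. w (beta_emb X x) = u x)"
proof -
  define h where "h x = (if x \<in> topspace X then u x else 0)" for x
  have "continuous_map X euclideanreal h"
    by (rule continuous_map_eq[of X euclideanreal u]) (use u in \<open>auto simp: continuous_map_in_subtopology h_def\<close>)
  then have h: "h \<in> unit_functions X"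
    using u by (auto simp: unit_functions_def C_space_def h_def continuous_map_in_subtopology image_subset_iff)
  have "continuous_map (beta X) (top_of_set {0..1::real}) (\<lambda>p. p h)"
    unfolding beta_def Let_def
    by (intro continuous_map_from_subtopology continuous_map_product_projection h)
  then have "continuous_map (beta X) euclideanreal (\<lambda>p. p h)"
    by (simp add: continuous_map_in_subtopology)
  moreover have "beta_emb X x h = u x" if "x \<in> topspace X" for x
    using h that by (simp add: beta_emb_def h_def)
  ultimately show ?thesis by blast
qed

text \<open>The extension has as its graph the closure \<open>R\<close> of the graph of
  \<open>f\<close>. Every point of \<beta>X has a value because the projection of \<open>R\<close>
  is closed and contains the dense image of \<open>X\<close>. Two values at \<open>p\<close> would
  be separated by some Urysohn function \<open>u\<close> on \<open>K\<close>, while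
  \<open>u \<circ> f\<close> extends continuously to \<beta>X by
  \<open>beta_extend_unit\<close>.\<close>

lemma beta_extend:
  assumes K: "compact_space K" "Hausdorff_space K" and f: "continuous_map X K f"
  shows "\<exists>g. continuous_map (beta X) K g \<and> (\<forall>x\<in>topspace X. g (beta_emb X x) = f x)"
proof -
  define G where "G = (\<lambda>x. (beta_emb X x, f x)) ` topspace X"
  define R where "R = prod_topology (beta X) K closure_of G"
  have R: "closedin (prod_topology (beta X) K) R" by (simp add: R_def)
  have fK: "f x \<in> topspace K" if "x \<in> topspace X" for x
    using continuous_map_image_subset_topspace[OF f] that by blast
  have GR: "G \<subseteq> R"
    unfolding R_def by (intro closure_of_subset) (auto simp: G_def beta_emb_in fK)
  have total: "\<exists>q. (p, q) \<in> R" if p: "p \<in> topspace (beta X)" for p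
  proof -
    have "closedin (beta X) (fst ` R)"
      using Abstract_Topological_Spaces.closed_map_fst[OF K(1)] R by (auto simp: closed_map_def)
    moreover have "beta_emb X ` topspace X \<subseteq> fst ` R"
      using GR by (force simp: G_def)
    ultimately have "beta X closure_of (beta_emb X ` topspace X) \<subseteq> fst ` R"
      by (rule closure_of_minimal[rotated])
    then have "p \<in> fst ` R" using p by (simp add: dense_beta subset_iff)
    then show ?thesis by auto
  qed
  have single: "q = q'" if q: "(p, q) \<in> R" and q': "(p, q') \<in> R" for p q q'
  proof (rule ccontr)
    assume "q \<noteq> q'"
    have RK: "p \<in> topspace (beta X)" "q \<in> topspace K" "q' \<in> topspace K"
      using closedin_subset[OF R] q q' by auto
    then obtain V V' where V: "openin K V" "openin K V'" "q \<in> V" "q' \<in> V'"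
      "K closure_of V \<inter> K closure_of V' = {}"
      using Hausdorff_regular_separation[OF K] \<open>q \<noteq> q'\<close> by metis
    obtain u :: "_ \<Rightarrow> real" where u: "continuous_map K (top_of_set {0..1}) u"
      "u ` (K closure_of V) \<subseteq> {0}" "u ` (K closure_of V') \<subseteq> {1}"
      using compact_Hausdorff_Urysohn[OF K _ _ V(5)] by auto
    have VV: "V \<subseteq> K closure_of V" "V' \<subseteq> K closure_of V'"
      using V(1,2) by (auto intro!: closure_of_subset openin_subset)
    have "continuous_map X (top_of_set {0..1::real}) (u \<circ> f)"
      using f u(1) continuous_map_compose by blast
    from beta_extend_unit[OF this] obtain w where w: "continuous_map (beta X) euclideanreal w"
      "\<And>x. x \<in> topspace X \<Longrightarrow> w (beta_emb X x) = u (f x)"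
      by auto
    \<comment> \<open>A product neighbourhood of \<open>(p, q)\<close> meets the graph of
      \<open>f\<close>; its first factor is chosen to avoid the value \<open>a\<close> of
      \<open>w\<close>.\<close>
    have near: "\<exists>x\<in>topspace X. f x \<in> V \<and> w (beta_emb X x) \<noteq> a"
      if pqR: "(p, q) \<in> R" and "openin K V" "q \<in> V" "w p \<noteq> a" for a :: real and V q
    proof -
      have "openin (beta X) {z \<in> topspace (beta X). w z \<in> - {a}}"
        using w(1) by (intro openin_continuous_map_preimage[where Y = euclidean]) auto
      then have "openin (prod_topology (beta X) K) ({z \<in> topspace (beta X). w z \<in> - {a}} \<times> V)"
        using \<open>openin K V\<close> by (simp add: openin_prod_Times_iff)
      moreover have "(p, q) \<in> {z \<in> topspace (beta X). w z \<in> - {a}} \<times> V"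
        using \<open>q \<in> V\<close> \<open>w p \<noteq> a\<close> RK(1) by simp
      ultimately obtain r where "r \<in> G" "r \<in> {z \<in> topspace (beta X). w z \<in> - {a}} \<times> V"
        using pqR unfolding R_def in_closure_of by meson
      then show ?thesis by (auto simp: G_def)
    qed
    have "w p = 0"
    proof (rule ccontr)
      assume "w p \<noteq> 0"
      then obtain x where x: "x \<in> topspace X" "f x \<in> V" "w (beta_emb X x) \<noteq> 0"
        using near[OF q V(1,3)] by blast
      then have "f x \<in> K closure_of V" using VV(1) by blast
      then show False using x w(2)[OF x(1)] u(2) by auto
    qed
    moreover have "w p = 1"
    proof (rule ccontr)
      assume "w p \<noteq> 1"
      then obtain x where x: "x \<in> topspace X" "f x \<in> V'" "w (beta_emb X x) \<noteq> 1"
        using near[OF q' V(2,4)] by blast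
      then have "f x \<in> K closure_of V'" using VV(2) by blast
      then show False using x w(2)[OF x(1)] u(3) by auto
    qed
    ultimately show False by simp
  qed
  have "\<exists>g. continuous_map (beta X) K g \<and> (\<forall>p q. (p, q) \<in> R \<longleftrightarrow> p \<in> topspace (beta X) \<and> q = g p)"
    by (rule single_valued_closed_relation_continuous[OF K(1) R]) (fact total, fact single)
  then obtain g where g: "continuous_map (beta X) K g"
    "\<And>p q. (p, q) \<in> R \<longleftrightarrow> p \<in> topspace (beta X) \<and> q = g p"
    by blast
  have "g (beta_emb X x) = f x" if "x \<in> topspace X" for x
    using GR g(2)[of "beta_emb X x" "f x"] that by (auto simp: G_def)
  then show ?thesis using g(1) by blast
qed

section \<open>Extensions with values in one-point compactifications\<close>

lemma extension_works:
  assumes "\<exists>g. continuous_map Z (Alexandroff_compactification euclidean) g \<and> (\<forall>x\<in>topspace X. g (j x) = Some (f x))"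
  shows "continuous_map Z (Alexandroff_compactification euclidean) (extension Z j X f)"
    and "x \<in> topspace X \<Longrightarrow> extension Z j X f (j x) = Some (f x)"
  using someI_ex[OF assms] unfolding extension_def by blast+

text \<open>Local compactness makes the one-point compactification Hausdorff, so
  \<open>beta_extend\<close> applies to it and shows that the choice in \<open>extension\<close> is
  not vacuous.\<close>

lemma beta_ext:
  fixes f :: "'a \<Rightarrow> 'v::metric_space"
  assumes "locally_compact_space (euclidean :: 'v topology)" and f: "continuous_map X euclidean f"
  shows continuous_map_beta_ext: "continuous_map (beta X) (Alexandroff_compactification euclidean) (beta_ext X f)"
    and beta_ext_emb: "x \<in> topspace X \<Longrightarrow> beta_ext X f (beta_emb X x) = Some (f x)"
proof -
  have "Hausdorff_space (Alexandroff_compactification (euclidean :: 'v topology))"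
    using assms(1) by (simp add: Hausdorff_space_Alexandroff_compactification Hausdorff_space_euclidean)
  moreover have "continuous_map X (Alexandroff_compactification euclidean) (Some \<circ> f)"
    using f continuous_map_Some continuous_map_compose by blast
  ultimately have ex: "\<exists>g. continuous_map (beta X) (Alexandroff_compactification euclidean) g \<and>
      (\<forall>x\<in>topspace X. g (beta_emb X x) = Some (f x))"
    using beta_extend[OF compact_space_Alexandroff_compactification] by fastforce
  show "continuous_map (beta X) (Alexandroff_compactification euclidean) (beta_ext X f)"
    and "x \<in> topspace X \<Longrightarrow> beta_ext X f (beta_emb X x) = Some (f x)"
    unfolding beta_ext_def by (rule extension_works[OF ex], rule extension_works[OF ex])
qed

text \<open>Closed balls are compact because the isometric isomorphism onto \<open>\<real>\<close> or \<open>\<complex>\<close> maps them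
  onto closed bounded sets.\<close>

lemma locally_compact_real_or_complex:
  "locally_compact_space (euclidean :: 'k::real_or_complex topology)"
proof -
  obtain \<phi> :: "'k \<Rightarrow> complex" where \<phi>: "\<And>a b. \<phi> (a + b) = \<phi> a + \<phi> b" "\<And>a. norm (\<phi> a) = norm a"
    "range \<phi> = \<real> \<or> range \<phi> = UNIV"
    using isometric_to_real_or_complex by blast
  have diff: "\<phi> (a - b) = \<phi> a - \<phi> b" for a b
    using \<phi>(1)[of "a - b" b] by simp
  have dist: "dist (\<phi> a) (\<phi> b) = dist a b" for a b
    by (simp add: dist_norm \<phi>(2) flip: diff)
  have inj: "inj \<phi>"
    using dist by (metis dist_eq_0_iff injI)
  have clo: "closed (range \<phi>)"
    using \<phi>(3) closed_complex_Reals by auto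
  have "compact (cball (a :: 'k) 1)" for a
  proof -
    have "compact (range \<phi> \<inter> cball (\<phi> a) 1)"
      using clo by (intro closed_Int_compact) auto
    moreover have "continuous_on (range \<phi>) (inv \<phi>)"
      unfolding continuous_on_iff
      using dist by (auto simp: inv_f_f[OF inj])
    ultimately have "compact (inv \<phi> ` (range \<phi> \<inter> cball (\<phi> a) 1))"
      by (meson compact_continuous_image continuous_on_subset inf_le1)
    moreover have "inv \<phi> ` (range \<phi> \<inter> cball (\<phi> a) 1) = cball a 1"
    proof
      show "inv \<phi> ` (range \<phi> \<inter> cball (\<phi> a) 1) \<subseteq> cball a 1"
        using dist by (auto simp: inv_f_f[OF inj])
      show "cball a 1 \<subseteq> inv \<phi> ` (range \<phi> \<inter> cball (\<phi> a) 1)"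
      proof
        fix b assume "b \<in> cball a 1"
        then have "\<phi> b \<in> range \<phi> \<inter> cball (\<phi> a) 1" by (simp add: dist)
        then show "b \<in> inv \<phi> ` (range \<phi> \<inter> cball (\<phi> a) 1)"
          using inv_f_f[OF inj] by (metis image_eqI)
      qed
    qed
    ultimately show ?thesis by simp
  qed
  then show ?thesis
    unfolding locally_compact_space_def
    by (metis ball_subset_cball centre_in_ball compactin_euclidean_iff open_ball open_openin zero_less_one)
qed

lemma locally_compact_real: "locally_compact_space euclideanreal"
  by (rule locally_compact_space_euclidean)

section \<open>The quotient \<gamma>X as a Hausdorff compactification of X\<close>

abbreviation gamma_proj ::
  "'a topology \<Rightarrow> ('a \<Rightarrow> 'k::topological_space) set \<Rightarrow> (('a \<Rightarrow> real) \<Rightarrow> real) \<Rightarrow> (('a \<Rightarrow> real) \<Rightarrow> real) set" where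
  "gamma_proj X A p \<equiv> beta_rel X A `` {p}"

lemma topspace_gamma: "topspace (gamma X A) = topspace (beta X) // beta_rel X A"
proof -
  have "\<Union>(topspace (beta X) // beta_rel X A) = topspace (beta X)"
    using Union_quotient[OF equiv_beta_rel] .
  then have "openin (gamma X A) (topspace (beta X) // beta_rel X A)"
    by (simp add: gamma_def openin_quotient_topology[OF equiv_beta_rel])
  moreover have "U \<subseteq> topspace (beta X) // beta_rel X A" if "openin (gamma X A) U" for U
    using that by (simp add: gamma_def openin_quotient_topology[OF equiv_beta_rel])
  ultimately show ?thesis
    by (intro subset_antisym) (simp_all add: openin_subset)
qed

lemma gamma_proj_eq_iff:
  "p \<in> topspace (beta X) \<Longrightarrow> q \<in> topspace (beta X) \<Longrightarrow>
    gamma_proj X A p = gamma_proj X A q \<longleftrightarrow> (p, q) \<in> beta_rel X A"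
  by (rule eq_equiv_class_iff[OF equiv_beta_rel])

lemma quotient_map_gamma: "quotient_map (beta X) (gamma X A) (gamma_proj X A)"
  unfolding quotient_map_def topspace_gamma
proof (intro conjI allI impI)
  show "gamma_proj X A ` topspace (beta X) = topspace (beta X) // beta_rel X A"
    by (auto simp: quotient_def)
  fix U assume U: "U \<subseteq> topspace (beta X) // beta_rel X A"
  \<comment> \<open>Since \<open>U\<close> consists of whole classes, the union by which
    \<open>quotient_topology\<close> tests openness is the preimage under the class map.\<close>
  have "{p \<in> topspace (beta X). gamma_proj X A p \<in> U} = \<Union>U"
  proof (intro set_eqI iffI)
    fix p assume "p \<in> {p \<in> topspace (beta X). gamma_proj X A p \<in> U}"
    then show "p \<in> \<Union>U" using equiv_class_self[OF equiv_beta_rel, of p X A] by blast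
  next
    fix p assume "p \<in> \<Union>U"
    then obtain P where P: "P \<in> U" "p \<in> P" by blast
    then obtain q where q: "q \<in> topspace (beta X)" "P = gamma_proj X A q"
      using U by (auto elim!: quotientE)
    then have "(q, p) \<in> beta_rel X A" using P by simp
    moreover from this have "p \<in> topspace (beta X)" by (simp add: beta_rel_def)
    ultimately have "gamma_proj X A p = P" "p \<in> topspace (beta X)"
      using q equiv_class_eq[OF equiv_beta_rel, of q p X A] by simp_all
    then show "p \<in> {p \<in> topspace (beta X). gamma_proj X A p \<in> U}" using P by simp
  qed
  then show "openin (beta X) {p \<in> topspace (beta X). gamma_proj X A p \<in> U} \<longleftrightarrow> openin (gamma X A) U"
    using U by (simp add: gamma_def openin_quotient_topology[OF equiv_beta_rel])
qed

lemma continuous_map_gamma_proj: "continuous_map (beta X) (gamma X A) (gamma_proj X A)"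
  using quotient_map_gamma quotient_imp_continuous_map by blast

lemma gamma_proj_surj: "gamma_proj X A ` topspace (beta X) = topspace (gamma X A)"
  using quotient_map_gamma by (rule quotient_imp_surjective_map)

lemma gamma_lift:
  assumes "continuous_map (beta X) K g" and "\<And>p q. (p, q) \<in> beta_rel X A \<Longrightarrow> g p = g q"
  shows "\<exists>G. continuous_map (gamma X A) K G \<and> (\<forall>p\<in>topspace (beta X). G (gamma_proj X A p) = g p)"
proof -
  have resp: "g p = g q"
    if "p \<in> topspace (beta X)" "q \<in> topspace (beta X)" "gamma_proj X A p = gamma_proj X A q" for p q
    using that assms(2) gamma_proj_eq_iff[OF that(1,2)] by blast
  show ?thesis
    by (rule quotient_map_lift_exists[OF quotient_map_gamma[of X A] assms(1)]) (fact resp, blast)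
qed

lemma compact_space_gamma: "compact_space (gamma X A)"
  using image_compactin[OF compact_space_beta[unfolded compact_space_def] continuous_map_gamma_proj[of X A]]
  by (simp add: compact_space_def gamma_proj_surj)

lemma continuous_map_gamma_emb: "continuous_map X (gamma X A) (gamma_emb X A)"
  using continuous_map_compose[OF continuous_map_beta_emb continuous_map_gamma_proj]
  by (simp add: o_def gamma_emb_def[abs_def])

lemma gamma_emb_in: "x \<in> topspace X \<Longrightarrow> gamma_emb X A x \<in> topspace (gamma X A)"
  using continuous_map_image_subset_topspace[OF continuous_map_gamma_emb[of X A]] by (simp add: image_subset_iff)

lemma dense_gamma: "gamma X A closure_of (gamma_emb X A ` topspace X) = topspace (gamma X A)"
proof
  show "gamma X A closure_of (gamma_emb X A ` topspace X) \<subseteq> topspace (gamma X A)"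
    by (rule closure_of_subset_topspace)
  have "gamma_proj X A ` (beta X closure_of (beta_emb X ` topspace X)) \<subseteq>
      gamma X A closure_of (gamma_proj X A ` beta_emb X ` topspace X)"
    by (rule continuous_map_image_closure_subset[OF continuous_map_gamma_proj])
  then show "topspace (gamma X A) \<subseteq> gamma X A closure_of (gamma_emb X A ` topspace X)"
    by (simp add: dense_beta gamma_proj_surj image_image gamma_emb_def)
qed

text \<open>Distinct classes are told apart by the extension of some \<open>f\<close> in
  \<open>A\<close>. It is constant on classes, hence descends to \<gamma>X, and disjoint open sets
  are pulled back from the Hausdorff space of its values.\<close>

lemma Hausdorff_space_gamma:
  fixes A :: "('a \<Rightarrow> 'k::real_or_complex) set"
  assumes "A \<subseteq> C_space X"
  shows "Hausdorff_space (gamma X A)"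
  unfolding Hausdorff_space_def
proof (intro allI impI, elim conjE)
  fix P Q assume "P \<in> topspace (gamma X A)" "Q \<in> topspace (gamma X A)" "P \<noteq> Q"
  then have "P \<in> gamma_proj X A ` topspace (beta X)" "Q \<in> gamma_proj X A ` topspace (beta X)"
    by (simp_all only: gamma_proj_surj)
  then obtain p q where pq: "p \<in> topspace (beta X)" "q \<in> topspace (beta X)"
    "P = gamma_proj X A p" "Q = gamma_proj X A q"
    by (elim imageE) rule
  then have "(p, q) \<notin> beta_rel X A"
    using \<open>P \<noteq> Q\<close> gamma_proj_eq_iff[OF pq(1,2), of A] by simp
  then obtain f where f: "f \<in> A" "beta_ext X f p \<noteq> beta_ext X f q"
    using pq by (auto simp: beta_rel_def)
  have "continuous_map X euclidean f" using f(1) assms by (auto simp: C_space_def)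
  from gamma_lift[OF continuous_map_beta_ext[OF locally_compact_real_or_complex this], of A] f(1)
  have "\<exists>G. continuous_map (gamma X A) (Alexandroff_compactification euclidean) G \<and>
      (\<forall>p\<in>topspace (beta X). G (gamma_proj X A p) = beta_ext X f p)"
    by (simp add: beta_rel_def)
  then obtain G where G: "continuous_map (gamma X A) (Alexandroff_compactification euclidean) G"
    "\<And>p. p \<in> topspace (beta X) \<Longrightarrow> G (gamma_proj X A p) = beta_ext X f p"
    by blast
  have "G P \<noteq> G Q" using G(2) pq f by simp
  moreover have "Hausdorff_space (Alexandroff_compactification (euclidean :: 'k topology))"
    using locally_compact_real_or_complex by (simp add: Hausdorff_space_Alexandroff_compactification)
  moreover have "G P \<in> topspace (Alexandroff_compactification euclidean)"
    "G Q \<in> topspace (Alexandroff_compactification euclidean)"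
    using continuous_map_image_subset_topspace[OF G(1)] \<open>P \<in> topspace (gamma X A)\<close>
      \<open>Q \<in> topspace (gamma X A)\<close> by blast+
  ultimately obtain U V where UV: "openin (Alexandroff_compactification euclidean) U"
    "openin (Alexandroff_compactification euclidean) V" "G P \<in> U" "G Q \<in> V" "disjnt U V"
    unfolding Hausdorff_space_def by meson
  let ?U = "{z \<in> topspace (gamma X A). G z \<in> U}" and ?V = "{z \<in> topspace (gamma X A). G z \<in> V}"
  have "openin (gamma X A) ?U" "openin (gamma X A) ?V"
    using openin_continuous_map_preimage[OF G(1)] UV by blast+
  moreover have "P \<in> ?U" "Q \<in> ?V" "disjnt ?U ?V"
    using UV \<open>P \<in> topspace (gamma X A)\<close> \<open>Q \<in> topspace (gamma X A)\<close> by (auto simp: disjnt_def)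
  ultimately show "\<exists>U V. openin (gamma X A) U \<and> openin (gamma X A) V \<and> P \<in> U \<and> Q \<in> V \<and> disjnt U V"
    by blast
qed

lemma gamma_ext_emb:
  fixes A :: "('a \<Rightarrow> 'k::real_or_complex) set"
  assumes "A \<subseteq> C_space X" and f: "f \<in> A" and x: "x \<in> topspace X"
  shows "gamma_ext X A f (gamma_emb X A x) = Some (f x)"
proof -
  have c: "continuous_map X euclidean f" using assms by (auto simp: C_space_def)
  from gamma_lift[OF continuous_map_beta_ext[OF locally_compact_real_or_complex c], of A] f
  have "\<exists>G. continuous_map (gamma X A) (Alexandroff_compactification euclidean) G \<and>
      (\<forall>p\<in>topspace (beta X). G (gamma_proj X A p) = beta_ext X f p)"
    by (simp add: beta_rel_def)
  then obtain G where G: "continuous_map (gamma X A) (Alexandroff_compactification euclidean) G"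
    "\<And>p. p \<in> topspace (beta X) \<Longrightarrow> G (gamma_proj X A p) = beta_ext X f p"
    by blast
  have "G (gamma_emb X A x) = Some (f x)" if "x \<in> topspace X" for x
    using G(2)[OF beta_emb_in[OF that]] beta_ext_emb[OF locally_compact_real_or_complex c that]
    by (simp add: gamma_emb_def)
  then show ?thesis
    unfolding gamma_ext_def using extension_works(2)[of "gamma X A" X "gamma_emb X A" f] G(1) x by blast
qed

text \<open>A function that is 0 at \<open>x\<close> and 1 off \<open>O'\<close> is extended to
  \<beta>X. The image in \<gamma>X of the set \<open>C\<close> where it equals 1 is closed, and its
  complement is the required \<open>V\<close>: the class of \<open>x\<close> is not hit, because the
  separation hypothesis identifies \<open>x\<close> with no other point of \<beta>X.\<close>

lemma gamma_emb_neighbourhood: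
  fixes A :: "('a \<Rightarrow> 'k::real_or_complex) set"
  assumes X: "completely_regular_space X" and A: "A \<subseteq> C_space X" and sep: "separates_points_from_beta X A"
    and O': "openin X O'" "x \<in> O'"
  obtains V where "openin (gamma X A) V" "gamma_emb X A x \<in> V"
    "\<And>y. y \<in> topspace X \<Longrightarrow> gamma_emb X A y \<in> V \<Longrightarrow> y \<in> O'"
proof -
  have x: "x \<in> topspace X" using O' openin_subset by blast
  have "closedin X (topspace X - O')" using O' by blast
  moreover have "x \<in> topspace X - (topspace X - O')" using x O' by blast
  ultimately obtain h :: "'a \<Rightarrow> real" where h: "continuous_map X (top_of_set {0..1}) h" "h x = 0"
    "h ` (topspace X - O') \<subseteq> {1}"
    using X unfolding completely_regular_space_def by meson
  obtain w where w: "continuous_map (beta X) euclideanreal w"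
      "\<And>x. x \<in> topspace X \<Longrightarrow> w (beta_emb X x) = h x"
    using beta_extend_unit[OF h(1)] by blast
  define C where "C = {p \<in> topspace (beta X). w p \<in> {1}}"
  have "closedin (beta X) C"
    unfolding C_def by (intro closedin_continuous_map_preimage[OF w(1)]) simp
  moreover have "closed_map (beta X) (gamma X A) (gamma_proj X A)"
    by (rule continuous_imp_closed_map[OF continuous_map_gamma_proj compact_space_beta Hausdorff_space_gamma[OF A]])
  ultimately have cl: "closedin (gamma X A) (gamma_proj X A ` C)"
    by (simp add: closed_map_def)
  show thesis
  proof
    show "openin (gamma X A) (topspace (gamma X A) - gamma_proj X A ` C)"
      using cl by blast
    have "gamma_emb X A x \<noteq> gamma_proj X A p" if "p \<in> C" for p
    proof
      assume eq: "gamma_emb X A x = gamma_proj X A p"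
      have p: "p \<in> topspace (beta X)" "w p = 1" using that by (auto simp: C_def)
      then have "(beta_emb X x, p) \<in> beta_rel X A"
        using eq unfolding gamma_emb_def by (simp only: gamma_proj_eq_iff[OF beta_emb_in[OF x] p(1)])
      moreover have "beta_emb X x \<noteq> p" using p(2) w(2)[OF x] h(2) by auto
      ultimately show False
        using sep x p(1) unfolding separates_points_from_beta_def beta_rel_def by blast
    qed
    then show "gamma_emb X A x \<in> topspace (gamma X A) - gamma_proj X A ` C"
      using gamma_emb_in[OF x, of A] by (auto simp del: Image_singleton_iff)
    fix y assume y: "y \<in> topspace X" "gamma_emb X A y \<in> topspace (gamma X A) - gamma_proj X A ` C"
    show "y \<in> O'"
    proof (rule ccontr)
      assume "y \<notin> O'"
      then have "w (beta_emb X y) = 1"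
        using y(1) h(3) w(2)[OF y(1)] by (simp add: image_subset_iff)
      then have "beta_emb X y \<in> C"
        using beta_emb_in[OF y(1)] by (simp add: C_def)
      then show False using y(2) unfolding gamma_emb_def by blast
    qed
  qed
qed

text \<open>Both injectivity and openness onto the image come from
  \<open>gamma_emb_neighbourhood\<close>, applied to the complement of a point and to a given open
  set.\<close>

lemma embedding_map_gamma_emb:
  fixes A :: "('a \<Rightarrow> 'k::real_or_complex) set"
  assumes X: "completely_regular_space X" "Hausdorff_space X" and A: "A \<subseteq> C_space X"
    and sep: "separates_points_from_beta X A"
  shows "embedding_map X (gamma X A) (gamma_emb X A)"
  unfolding embedding_map_def
proof (rule bijective_open_imp_homeomorphic_map)
  let ?j = "gamma_emb X A"
  let ?S = "subtopology (gamma X A) (?j ` topspace X)"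
  show "continuous_map X ?S ?j"
    by (rule continuous_map_into_subtopology[OF continuous_map_gamma_emb]) (rule Pi_I, rule imageI)
  show "?j ` topspace X = topspace ?S"
    using continuous_map_image_subset_topspace[OF continuous_map_gamma_emb[of X A]]
    by (simp add: inf.absorb2)
  show "inj_on ?j (topspace X)"
  proof (rule inj_onI, rule ccontr)
    fix x y assume xy: "x \<in> topspace X" "y \<in> topspace X" "?j x = ?j y" "x \<noteq> y"
    have "openin X (topspace X - {y})"
      using X(2) xy(2) by (simp add: closedin_Hausdorff_sing_eq openin_diff)
    moreover have "x \<in> topspace X - {y}" using xy by simp
    ultimately obtain V where "openin (gamma X A) V" and V: "?j x \<in> V"
      "\<And>y'. y' \<in> topspace X \<Longrightarrow> ?j y' \<in> V \<Longrightarrow> y' \<in> topspace X - {y}"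
      by (rule gamma_emb_neighbourhood[OF X(1) A sep]) (rule that)
    have "?j y \<in> V" using V(1) xy(3) by simp
    then show False using V(2)[OF xy(2)] by simp
  qed
  show "open_map X ?S ?j"
    unfolding open_map_def
  proof (intro allI impI)
    fix O' assume O': "openin X O'"
    have "\<exists>T. openin ?S T \<and> z \<in> T \<and> T \<subseteq> ?j ` O'" if z: "z \<in> ?j ` O'" for z
    proof -
      obtain x where x: "x \<in> O'" "z = ?j x" using z by blast
      obtain V where V: "openin (gamma X A) V" "?j x \<in> V" "\<And>y. y \<in> topspace X \<Longrightarrow> ?j y \<in> V \<Longrightarrow> y \<in> O'"
        by (rule gamma_emb_neighbourhood[OF X(1) A sep O' x(1)]) (rule that)
      have "openin ?S (V \<inter> ?j ` topspace X)" using V(1) by (rule openin_subtopology_Int)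
      moreover have "z \<in> V \<inter> ?j ` topspace X" using V(2) x openin_subset[OF O'] by blast
      moreover have "V \<inter> ?j ` topspace X \<subseteq> ?j ` O'" using V(3) by blast
      ultimately show ?thesis by blast
    qed
    then show "openin ?S (?j ` O')" by (subst openin_subopen) (rule ballI)
  qed
qed

section \<open>Strongly regular rings separate closed sets\<close>

lemma strongly_regular_at:
  fixes A :: "('a \<Rightarrow> 'k::real_or_complex) set"
  assumes A: "strongly_regular X A" and "c \<in> topspace (gamma X A)" "closedin (gamma X A) K" "K \<noteq> {}" "c \<notin> K"
  obtains f U where "f \<in> A" "openin (gamma X A) U" "c \<in> U"
    "\<And>x. x \<in> topspace X \<Longrightarrow> gamma_emb X A x \<in> U \<Longrightarrow> f x = 1"
    "\<And>x. x \<in> topspace X \<Longrightarrow> gamma_emb X A x \<in> K \<Longrightarrow> f x = 0"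
proof -
  have AC: "A \<subseteq> C_space X" using A by (simp add: strongly_regular_def function_subring_def)
  obtain f U where f: "f \<in> A" "openin (gamma X A) U" "c \<in> U"
    "\<forall>u\<in>U. gamma_ext X A f u = Some 1" "\<forall>u\<in>K. gamma_ext X A f u = Some 0"
    using A assms(2-) unfolding strongly_regular_def by meson
  show thesis
  proof (rule that[OF f(1-3)])
    show "f x = 1" if "x \<in> topspace X" "gamma_emb X A x \<in> U" for x
      using f(4) gamma_ext_emb[OF AC f(1) that(1)] that(2) by simp
    show "f x = 0" if "x \<in> topspace X" "gamma_emb X A x \<in> K" for x
      using f(5) gamma_ext_emb[OF AC f(1) that(1)] that(2) by simp
  qed
qed

text \<open>Strong regularity treats one point of \<open>K\<close> at a time; by compactness
  finitely many of the resulting neighbourhoods cover \<open>K\<close>, and their functions are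
  combined one by one.\<close>

lemma strongly_regular_separates:
  fixes A :: "('a \<Rightarrow> 'k::real_or_complex) set"
  assumes A: "strongly_regular X A" and K: "closedin (gamma X A) K" and K': "closedin (gamma X A) K'"
    and ne: "K' \<noteq> {}" and disj: "K \<inter> K' = {}"
  shows "\<exists>a\<in>A. \<forall>x\<in>topspace X. (gamma_emb X A x \<in> K \<longrightarrow> a x = 1) \<and> (gamma_emb X A x \<in> K' \<longrightarrow> a x = 0)"
proof -
  have add: "additive_subgroup A" and mult: "\<And>f g. f \<in> A \<Longrightarrow> g \<in> A \<Longrightarrow> (\<lambda>x. f x * g x) \<in> A"
    using A by (auto simp: strongly_regular_def function_subring_def)
  define good where "good c f U \<longleftrightarrow> f \<in> A \<and> openin (gamma X A) U \<and> c \<in> U \<and>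
    (\<forall>x\<in>topspace X. gamma_emb X A x \<in> U \<longrightarrow> f x = 1) \<and>
    (\<forall>x\<in>topspace X. gamma_emb X A x \<in> K' \<longrightarrow> f x = 0)" for c f U
  have "\<exists>f U. good c f U" if c: "c \<in> K" for c
  proof -
    have "c \<in> topspace (gamma X A)" "c \<notin> K'" using closedin_subset[OF K] c disj by blast+
    then obtain f U where "f \<in> A" "openin (gamma X A) U" "c \<in> U"
      "\<And>x. x \<in> topspace X \<Longrightarrow> gamma_emb X A x \<in> U \<Longrightarrow> f x = 1"
      "\<And>x. x \<in> topspace X \<Longrightarrow> gamma_emb X A x \<in> K' \<Longrightarrow> f x = 0"
      using strongly_regular_at[OF A _ K' ne] by blast
    then show ?thesis unfolding good_def by blast
  qed
  then obtain f U where "\<And>c. c \<in> K \<Longrightarrow> good c (f c) (U c)" by metis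
  then have fA: "\<And>c. c \<in> K \<Longrightarrow> f c \<in> A" and U: "\<And>c. c \<in> K \<Longrightarrow> openin (gamma X A) (U c)"
    "\<And>c. c \<in> K \<Longrightarrow> c \<in> U c"
    and f1: "\<And>c x. c \<in> K \<Longrightarrow> x \<in> topspace X \<Longrightarrow> gamma_emb X A x \<in> U c \<Longrightarrow> f c x = 1"
    and f0: "\<And>c x. c \<in> K \<Longrightarrow> x \<in> topspace X \<Longrightarrow> gamma_emb X A x \<in> K' \<Longrightarrow> f c x = 0"
    by (simp_all add: good_def)
  have "compactin (gamma X A) K"
    using K compact_space_gamma closedin_compact_space by blast
  moreover have "\<forall>P\<in>U ` K. openin (gamma X A) P" "K \<subseteq> \<Union>(U ` K)"
    using U by blast+
  ultimately obtain F where F: "finite F" "F \<subseteq> U ` K" "K \<subseteq> \<Union>F"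
    unfolding compactin_def by meson
  then obtain C where C: "C \<subseteq> K" "finite C" "F = U ` C"
    using finite_subset_image by metis
  have "\<exists>a\<in>A. \<forall>x\<in>topspace X. (gamma_emb X A x \<in> \<Union>(U ` C) \<longrightarrow> a x = 1) \<and>
      (gamma_emb X A x \<in> K' \<longrightarrow> a x = 0)"
    using C(2,1)
  proof (induction C)
    case empty
    have "(\<lambda>x. 0) \<in> A" using add by (simp add: additive_subgroup_def)
    then show ?case by (intro bexI[of _ "\<lambda>x. 0"]) auto
  next
    case (insert c C)
    then obtain a where a: "a \<in> A" "\<And>x. x \<in> topspace X \<Longrightarrow> gamma_emb X A x \<in> \<Union>(U ` C) \<Longrightarrow> a x = 1"
      "\<And>x. x \<in> topspace X \<Longrightarrow> gamma_emb X A x \<in> K' \<Longrightarrow> a x = 0"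
      by auto
    have c: "c \<in> K" using insert by blast
    \<comment> \<open>This is \<open>1 - (1 - a) * (1 - f c)\<close>, expanded because
      \<open>A\<close> may lack the constant 1. It is 1 where either function is 1 and 0 where both
      are 0.\<close>
    have "(\<lambda>x. (a x + f c x) - a x * f c x) \<in> A"
      by (rule additive_subgroup_diff[OF add additive_subgroup_add[OF add a(1) fA[OF c]] mult[OF a(1) fA[OF c]]])
    moreover have "(a x + f c x) - a x * f c x = 1"
      if "x \<in> topspace X" "gamma_emb X A x \<in> \<Union>(U ` insert c C)" for x
      using that a(2)[OF that(1)] f1[OF c that(1)] by (cases "gamma_emb X A x \<in> U c") auto
    moreover have "(a x + f c x) - a x * f c x = 0"
      if "x \<in> topspace X" "gamma_emb X A x \<in> K'" for x
      using that a(3) f0[OF c] by simp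
    ultimately show ?case by (intro bexI[of _ "\<lambda>x. (a x + f c x) - a x * f c x"]) blast+
  qed
  then show ?thesis using F(3) C(3) by blast
qed

section \<open>Situation 1 yields the abstract setting\<close>

text \<open>If the relation is equality, extensions to \<beta>X pass to \<gamma>X unchanged.
  Otherwise compatibility makes the extended norms descend to \<gamma>X, and an \<open>h\<close>
  whose extended norm is nonzero at \<open>c\<close> shows that \<open>c\<close> is visible.\<close>

lemma situation1_visible_or_extend:
  fixes A :: "('a \<Rightarrow> 'k::real_or_complex) set" and M :: "('a \<Rightarrow> 'e::real_normed_vector) set"
  assumes "situation1 X sc A M"
  shows "(\<forall>c\<in>topspace (gamma X A). visible (gamma X A) (gamma_emb X A) X M c) \<or>
      (\<forall>u. continuous_map X (top_of_set {0..1::real}) u \<longrightarrow>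
         (\<exists>w. continuous_map (gamma X A) euclideanreal w \<and> (\<forall>x\<in>topspace X. w (gamma_emb X A x) = u x)))"
proof (cases "beta_rel X A = Id_on (topspace (beta X))")
  case True
  have "\<exists>w. continuous_map (gamma X A) euclideanreal w \<and> (\<forall>x\<in>topspace X. w (gamma_emb X A x) = u x)"
    if u: "continuous_map X (top_of_set {0..1::real}) u" for u
  proof -
    obtain v where v: "continuous_map (beta X) euclideanreal v" "\<And>x. x \<in> topspace X \<Longrightarrow> v (beta_emb X x) = u x"
      using beta_extend_unit[OF u] by blast
    have "\<exists>w. continuous_map (gamma X A) euclideanreal w \<and>
        (\<forall>p\<in>topspace (beta X). w (gamma_proj X A p) = v p)"
      by (rule gamma_lift[OF v(1)]) (simp add: True Id_on_iff)
    then obtain w where w: "continuous_map (gamma X A) euclideanreal w"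
      "\<And>p. p \<in> topspace (beta X) \<Longrightarrow> w (gamma_proj X A p) = v p"
      by blast
    have "w (gamma_emb X A x) = u x" if "x \<in> topspace X" for x
      using w(2)[OF beta_emb_in[OF that]] v(2)[OF that] by (simp add: gamma_emb_def)
    then show ?thesis using w(1) by blast
  qed
  then show ?thesis by blast
next
  case False
  have M: "M \<subseteq> C_space X" and compat: "\<And>p q f. (p, q) \<in> beta_rel X A \<Longrightarrow> f \<in> M \<Longrightarrow>
      norm_beta_ext X f p = norm_beta_ext X f q"
    and nz: "\<And>p. p \<in> topspace (beta X) \<Longrightarrow> \<exists>f\<in>M. norm_beta_ext X f p \<noteq> Some 0"
    using assms False unfolding situation1_def compatible_def function_module_def by blast+
  have "\<exists>F. continuous_map (gamma X A) (Alexandroff_compactification euclideanreal) F \<and>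
      (\<forall>p\<in>topspace (beta X). F (gamma_proj X A p) = norm_beta_ext X f p) \<and>
      (\<forall>x\<in>topspace X. F (gamma_emb X A x) = Some (norm (f x)))" if f: "f \<in> M" for f
  proof -
    have "continuous_map X euclidean f" using f M by (auto simp: C_space_def)
    then have c: "continuous_map X euclideanreal (\<lambda>x. norm (f x))"
      by (rule continuous_map_norm)
    have "\<exists>F. continuous_map (gamma X A) (Alexandroff_compactification euclideanreal) F \<and>
        (\<forall>p\<in>topspace (beta X). F (gamma_proj X A p) = norm_beta_ext X f p)"
      by (rule gamma_lift[OF continuous_map_beta_ext[OF locally_compact_real c, folded norm_beta_ext_def]])
        (rule compat[OF _ f])
    then obtain F where F: "continuous_map (gamma X A) (Alexandroff_compactification euclideanreal) F"
      "\<And>p. p \<in> topspace (beta X) \<Longrightarrow> F (gamma_proj X A p) = norm_beta_ext X f p"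
      by blast
    have "F (gamma_emb X A x) = Some (norm (f x))" if "x \<in> topspace X" for x
      using F(2)[OF beta_emb_in[OF that]] beta_ext_emb[OF locally_compact_real c that]
      by (simp add: gamma_emb_def norm_beta_ext_def)
    then show ?thesis using F by blast
  qed
  then obtain F where Fc: "\<And>f. f \<in> M \<Longrightarrow> continuous_map (gamma X A) (Alexandroff_compactification euclideanreal) (F f)"
    and Fp: "\<And>f p. f \<in> M \<Longrightarrow> p \<in> topspace (beta X) \<Longrightarrow> F f (gamma_proj X A p) = norm_beta_ext X f p"
    and Fx: "\<And>f x. f \<in> M \<Longrightarrow> x \<in> topspace X \<Longrightarrow> F f (gamma_emb X A x) = Some (norm (f x))"
    by metis
  have H: "Hausdorff_space (Alexandroff_compactification euclideanreal)"
    using locally_compact_real by (simp add: Hausdorff_space_Alexandroff_compactification)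
  have "visible (gamma X A) (gamma_emb X A) X M c" if c: "c \<in> topspace (gamma X A)" for c
  proof -
    have "c \<in> gamma_proj X A ` topspace (beta X)" using c by (simp only: gamma_proj_surj)
    then obtain p where p: "p \<in> topspace (beta X)" "c = gamma_proj X A p"
      by (elim imageE) rule
    obtain h where h: "h \<in> M" "norm_beta_ext X h p \<noteq> Some 0" using nz p(1) by blast
    have "False" if k: "k \<in> M"
      and c1: "c \<in> gamma X A closure_of (gamma_emb X A ` {x \<in> topspace X. k x = h x})"
      and c0: "c \<in> gamma X A closure_of (gamma_emb X A ` {x \<in> topspace X. k x = 0})" for k
    proof -
      \<comment> \<open>Continuity carries both equations from \<open>X\<close> to \<open>c\<close>,
        forcing \<open>F h c = Some 0\<close>. The value \<open>F h c\<close> may be the point at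
        infinity, which contradicts this just as well.\<close>
      have "F k c = F h c"
        by (rule forall_in_closure_of_eq[OF c1 H Fc[OF k] Fc[OF h(1)]]) (auto simp: Fx k h(1))
      moreover have "F k c = Some 0"
        by (rule forall_in_closure_of_eq[OF c0 H Fc[OF k], where g = "\<lambda>_. Some 0"]) (auto simp: Fx k)
      ultimately show False using Fp[OF h(1) p(1)] p(2) h(2) by simp
    qed
    then show ?thesis unfolding visible_def using h(1) by blast
  qed
  then show ?thesis by blast
qed

text \<open>For \<open>cut\<close>, \<open>h\<close> is multiplied by a ring element that is 1 on
  \<open>K\<close> and 0 on \<open>K'\<close>; for \<open>local\<close>, a function nonzero at
  \<open>x\<close> is multiplied by one that is 1 at \<open>x\<close> and 0 off \<open>U\<close>.
  The cases of an empty \<open>K'\<close> and of \<open>U\<close> being the whole space are split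
  off because strong regularity speaks of nonempty closed sets.\<close>

lemma situation1_function_compactification:
  fixes A :: "('a \<Rightarrow> 'k::real_or_complex) set" and M :: "('a \<Rightarrow> 'e::real_normed_vector) set"
  assumes X: "completely_regular_space X" "Hausdorff_space X" and sc: "normed_space_over sc"
    and sit: "situation1 X sc A M"
  shows "function_compactification X (gamma X A) (gamma_emb X A) M"
proof -
  interpret normed_space_over sc by (rule sc)
  have A: "strongly_regular X A" and compat: "compatible X sc A M"
    using sit by (simp_all add: situation1_def)
  have AC: "A \<subseteq> C_space X" and sep: "separates_points_from_beta X A"
    using A by (simp_all add: strongly_regular_def function_subring_def)
  have MC: "M \<subseteq> C_space X" and add: "additive_subgroup M"
    and mod: "\<And>a f. a \<in> A \<Longrightarrow> f \<in> M \<Longrightarrow> (\<lambda>x. sc (a x) (f x)) \<in> M"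
    and pt: "\<And>x. x \<in> topspace X \<Longrightarrow> \<exists>f\<in>M. f x \<noteq> 0"
    using compat by (simp_all add: compatible_def function_module_def)
  have H: "Hausdorff_space (gamma X A)" by (rule Hausdorff_space_gamma[OF AC])
  let ?j = "gamma_emb X A"
  show ?thesis
  proof
    show "compact_space (gamma X A)" by (rule compact_space_gamma)
    show "Hausdorff_space (gamma X A)" by (rule H)
    show "embedding_map X (gamma X A) ?j" by (rule embedding_map_gamma_emb[OF X AC sep])
    show "gamma X A closure_of (?j ` topspace X) = topspace (gamma X A)" by (rule dense_gamma)
    show "M \<subseteq> C_space X" "additive_subgroup M" by fact+
    show "(\<forall>c\<in>topspace (gamma X A). visible (gamma X A) ?j X M c) \<or>
      (\<forall>u. continuous_map X (top_of_set {0..1::real}) u \<longrightarrow>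
         (\<exists>w. continuous_map (gamma X A) euclideanreal w \<and> (\<forall>x\<in>topspace X. w (?j x) = u x)))"
      by (rule situation1_visible_or_extend[OF sit])
  next
    fix h K K'
    assume h: "h \<in> M" and K: "closedin (gamma X A) K" "closedin (gamma X A) K'" "K \<inter> K' = {}"
    show "\<exists>k\<in>M. \<forall>x\<in>topspace X. (?j x \<in> K \<longrightarrow> k x = h x) \<and> (?j x \<in> K' \<longrightarrow> k x = 0)"
    proof (cases "K' = {}")
      case True
      then show ?thesis using h by blast
    next
      case False
      obtain a where a: "a \<in> A" "\<And>x. x \<in> topspace X \<Longrightarrow> ?j x \<in> K \<Longrightarrow> a x = 1"
        "\<And>x. x \<in> topspace X \<Longrightarrow> ?j x \<in> K' \<Longrightarrow> a x = 0"
        using strongly_regular_separates[OF A K(1,2) False K(3)] by blast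
      then show ?thesis
        by (intro bexI[OF _ mod[OF a(1) h]]) simp
    qed
  next
    fix x U
    assume x: "x \<in> topspace X" and U: "openin (gamma X A) U" "?j x \<in> U"
    obtain f where f: "f \<in> M" "f x \<noteq> 0" using pt[OF x] by blast
    show "\<exists>f\<in>M. f x \<noteq> 0 \<and> ?j ` cozero X f \<subseteq> U"
    proof (cases "topspace (gamma X A) - U = {}")
      case True
      then have "?j y \<in> U" if "y \<in> topspace X" for y using gamma_emb_in[OF that, of A] by blast
      then have "?j ` cozero X f \<subseteq> U" by (simp add: image_subset_iff)
      then show ?thesis using f by blast
    next
      case False
      have "closedin (gamma X A) {?j x}"
        using H gamma_emb_in[OF x] by (simp add: closedin_Hausdorff_sing_eq)
      moreover have "closedin (gamma X A) (topspace (gamma X A) - U)" using U(1) by blast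
      moreover have "{?j x} \<inter> (topspace (gamma X A) - U) = {}" using U(2) by blast
      ultimately have "\<exists>a\<in>A. \<forall>y\<in>topspace X. (?j y \<in> {?j x} \<longrightarrow> a y = 1) \<and>
          (?j y \<in> topspace (gamma X A) - U \<longrightarrow> a y = 0)"
        by (intro strongly_regular_separates[OF A _ _ False])
      then obtain a where a: "a \<in> A" "a x = 1"
        "\<And>y. y \<in> topspace X \<Longrightarrow> ?j y \<in> topspace (gamma X A) - U \<Longrightarrow> a y = 0"
        using x by blast
      have "?j y \<in> U" if "y \<in> cozero X (\<lambda>y. sc (a y) (f y))" for y
      proof (rule ccontr)
        assume "?j y \<notin> U"
        then have "a y = 0" using a(3) that gamma_emb_in[of y X A] by simp
        then show False using that by simp
      qed
      then have "?j ` cozero X (\<lambda>y. sc (a y) (f y)) \<subseteq> U" by (rule image_subsetI)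
      moreover have "sc (a x) (f x) \<noteq> 0" using a(2) f(2) by simp
      ultimately show ?thesis by (intro bexI[OF _ mod[OF a(1) f(1)]] conjI)
    qed
  qed
qed

theorem theorem3p1:
  fixes X :: "'a topology" and Y :: "'b topology"
    and scaleE :: "'k::real_or_complex \<Rightarrow> 'e::real_normed_vector \<Rightarrow> 'e"
    and scaleF :: "'k \<Rightarrow> 'f::real_normed_vector \<Rightarrow> 'f"
    and A :: "('a \<Rightarrow> 'k) set" and AXE :: "('a \<Rightarrow> 'e) set"
    and B :: "('b \<Rightarrow> 'k) set" and AYF :: "('b \<Rightarrow> 'f) set"
    and T :: "('a \<Rightarrow> 'e) \<Rightarrow> ('b \<Rightarrow> 'f)"
  assumes "completely_regular_space X" and "Hausdorff_space X"
    and "completely_regular_space Y" and "Hausdorff_space Y"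
    and "normed_space_over scaleE" and "normed_space_over scaleF"
    and "situation1 X scaleE A AXE" and "situation1 Y scaleF B AYF"
    and "biseparating X Y AXE AYF T"
  shows "gamma X A homeomorphic_space gamma Y B"
proof -
  interpret X: function_compactification X "gamma X A" "gamma_emb X A" AXE
    by (rule situation1_function_compactification) fact+
  interpret Y: function_compactification Y "gamma Y B" "gamma_emb Y B" AYF
    by (rule situation1_function_compactification) fact+
  have T: "bij_betw T AXE AYF" "separating X Y AXE AYF T" "separating Y X AYF AXE (inv_into AXE T)"
    using assms(9) by (auto simp: biseparating_def)
  interpret biseparating_pair X "gamma X A" "gamma_emb X A" AXE Y "gamma Y B" "gamma_emb Y B" AYF
    T "inv_into AXE T"
    using T by unfold_locales (auto simp: bij_betw_inv_into_left bij_betw_inv_into_right)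
  show ?thesis by (rule homeomorphic)
qed

end
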